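(* Let $D$ be a weighted oriented graph, let $U\subseteq V^+(D)$ be the set of vertices of non-trivial weight which are sinks, and let $D'$ be the weighted oriented graph obtained from $D$ by replacing the weight of each vertex of $U$ by $1$. Let $I=I(D)$ and $\tilde I=I(D')$. Then for each $s\ge1$, $\tilde I^{(s)}=\tilde I^{\,s}$ if and only if $I^{(s)}=I^s$.
   Context: Let $k$ be a field. A weighted oriented graph $D=(V(D),E(D),w)$ has a finite vertex set $V(D)$, a set $E(D)$ of ordered pairs of distinct vertices ($(x,y)\in E(D)$ is a directed edge from $x$ to $y$), each edge $\{x,y\}$ of the underlying simple graph $G$ carrying exactly one orientation, and a weight function $w:V(D)\to\mathbb N=\{1,2,\dots\}$. A vertex is a source (resp. sink) if it has only outgoing (resp. only incoming) edges; convention: sources have weight $1$. $V^+(D)=\{x:w(x)\ne1\}$. The edge ideal of $D$ is $I(D)=(x\,y^{w(y)} : (x,y)\in E(D))$ in the polynomial ring $R$ over $k$ whose variables are the vertices of $D$. For $s\ge1$ the $s$-th symbolic power of an ideal $I$ is $I^{(s)}=\bigcap_{P\in\operatorname{Ass}(I)}(I^sR_P\cap R)$, where $\operatorname{Ass}(I)$ is the set of associated primes of $R/I$. *)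

theory Defs
  imports "HOL-Library.Poly_Mapping" "HOL-Algebra.QuotRing" "HOL-Algebra.Ideal_Product"
begin

section \<open>Weighted oriented graphs\<close>

record 'v wo_graph =
  verts :: "'v set"
  edges :: "('v \<times> 'v) set"
  weight :: "'v \<Rightarrow> nat"

text \<open>An isolated vertex is both a source and a sink.\<close>

definition is_source :: "('v, 'm) wo_graph_scheme \<Rightarrow> 'v \<Rightarrow> bool" where
  "is_source D x \<longleftrightarrow> x \<in> verts D \<and> (\<forall>y. (y, x) \<notin> edges D)"

definition is_sink :: "('v, 'm) wo_graph_scheme \<Rightarrow> 'v \<Rightarrow> bool" where
  "is_sink D x \<longleftrightarrow> x \<in> verts D \<and> (\<forall>y. (x, y) \<notin> edges D)"

locale weighted_oriented_graph =
  fixes D :: "('v, 'm) wo_graph_scheme"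
  assumes finite_verts: "finite (verts D)"
    and edges_in_verts: "edges D \<subseteq> verts D \<times> verts D"
    and no_loops: "(x, x) \<notin> edges D"
    and one_orientation: "(x, y) \<in> edges D \<Longrightarrow> (y, x) \<notin> edges D"
    and weight_pos: "x \<in> verts D \<Longrightarrow> weight D x \<ge> 1"
    and weight_source: "is_source D x \<Longrightarrow> weight D x = 1"

definition nontrivial_verts :: "('v, 'm) wo_graph_scheme \<Rightarrow> 'v set" where
  "nontrivial_verts D = {x \<in> verts D. weight D x \<noteq> 1}"


section \<open>Polynomials with variables in a given set\<close>

text \<open>
  A monomial is a finitely supported exponent vector of type \<^typ>\<open>'v \<Rightarrow>\<^sub>0 nat\<close>, and a polynomial
  is a finitely supported coefficient function on monomials.
\<close>

type_synonym ('v, 'k) mpoly = "('v \<Rightarrow>\<^sub>0 nat) \<Rightarrow>\<^sub>0 'k"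

definition mpoly_ring :: "'v set \<Rightarrow> ('v, 'k::field) mpoly ring" where
  "mpoly_ring V =
    \<lparr>carrier = {p. \<forall>m \<in> Poly_Mapping.keys p. Poly_Mapping.keys m \<subseteq> V},
     mult = (*), one = 1, zero = 0, add = (+)\<rparr>"

definition var :: "'v \<Rightarrow> ('v, 'k::field) mpoly" where
  "var x = Poly_Mapping.single (Poly_Mapping.single x 1) 1"

definition edge_ideal :: "('v, 'm) wo_graph_scheme \<Rightarrow> ('v, 'k::field) mpoly set" where
  "edge_ideal D =
    Idl\<^bsub>mpoly_ring (verts D)\<^esub> {var x * var y ^ weight D y |x y. (x, y) \<in> edges D}"


section \<open>Localization at a multiplicative set\<close>

definition frac_rel :: "('a, 'm) ring_scheme \<Rightarrow> 'a set \<Rightarrow> (('a \<times> 'a) \<times> ('a \<times> 'a)) set" where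
  "frac_rel R S = {((a, s), (b, t)). a \<in> carrier R \<and> b \<in> carrier R \<and> s \<in> S \<and> t \<in> S \<and>
     (\<exists>u \<in> S. u \<otimes>\<^bsub>R\<^esub> (a \<otimes>\<^bsub>R\<^esub> t \<ominus>\<^bsub>R\<^esub> b \<otimes>\<^bsub>R\<^esub> s) = \<zero>\<^bsub>R\<^esub>)}"

definition frac :: "('a, 'm) ring_scheme \<Rightarrow> 'a set \<Rightarrow> 'a \<Rightarrow> 'a \<Rightarrow> ('a \<times> 'a) set" where
  "frac R S a s = frac_rel R S `` {(a, s)}"

text \<open>
  As for quotient rings in the library, the operations on classes are unions over all
  representatives.
\<close>

definition localization :: "('a, 'm) ring_scheme \<Rightarrow> 'a set \<Rightarrow> ('a \<times> 'a) set ring" where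
  "localization R S =
    \<lparr>carrier = (carrier R \<times> S) // frac_rel R S,
     mult = (\<lambda>X Y. \<Union>(a, s) \<in> X. \<Union>(b, t) \<in> Y. frac R S (a \<otimes>\<^bsub>R\<^esub> b) (s \<otimes>\<^bsub>R\<^esub> t)),
     one = frac R S \<one>\<^bsub>R\<^esub> \<one>\<^bsub>R\<^esub>,
     zero = frac R S \<zero>\<^bsub>R\<^esub> \<one>\<^bsub>R\<^esub>,
     add = (\<lambda>X Y. \<Union>(a, s) \<in> X. \<Union>(b, t) \<in> Y.
              frac R S (a \<otimes>\<^bsub>R\<^esub> t \<oplus>\<^bsub>R\<^esub> b \<otimes>\<^bsub>R\<^esub> s) (s \<otimes>\<^bsub>R\<^esub> t))\<rparr>"

text \<open>The ideal \<open>J R\<^sub>P \<inter> R\<close>, where \<open>R\<^sub>P\<close> is the localization at the complement of \<open>P\<close>.\<close>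

definition local_contraction :: "('a, 'm) ring_scheme \<Rightarrow> 'a set \<Rightarrow> 'a set \<Rightarrow> 'a set" where
  "local_contraction R P J =
    {f \<in> carrier R. frac R (carrier R - P) f \<one>\<^bsub>R\<^esub>
       \<in> Idl\<^bsub>localization R (carrier R - P)\<^esub> ((\<lambda>g. frac R (carrier R - P) g \<one>\<^bsub>R\<^esub>) ` J)}"


section \<open>Associated primes and symbolic powers\<close>

text \<open>
  The associated primes of the module \<open>R/I\<close>: prime ideals that are annihilators of an
  element of \<open>R/I\<close>, on which \<open>r \<in> R\<close> acts as multiplication by its residue class.
\<close>

definition assoc_primes :: "('a, 'm) ring_scheme \<Rightarrow> 'a set \<Rightarrow> 'a set set" where
  "assoc_primes R I = {P. primeideal P R \<and>
     (\<exists>m \<in> carrier (R Quot I).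
        P = {r \<in> carrier R. (I +>\<^bsub>R\<^esub> r) \<otimes>\<^bsub>R Quot I\<^esub> m = \<zero>\<^bsub>R Quot I\<^esub>})}"

definition ideal_power :: "('a, 'm) ring_scheme \<Rightarrow> 'a set \<Rightarrow> nat \<Rightarrow> 'a set" where
  "ideal_power R I s = I [^]\<^bsub>ideals_set R\<^esub> s"

text \<open>Intersecting with the carrier makes an empty intersection equal to the whole ring.\<close>

definition symbolic_power :: "('a, 'm) ring_scheme \<Rightarrow> 'a set \<Rightarrow> nat \<Rightarrow> 'a set" where
  "symbolic_power R I s =
    carrier R \<inter> (\<Inter>P \<in> assoc_primes R I. local_contraction R P (ideal_power R I s))"

end

theory Submission
  imports Defs
begin

text \<open>
  A vertex of \<open>U\<close> occurs in the generators of \<open>I\<close> only with exponent equal to its weight, so \<open>I\<close> is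
  the extension of \<open>I'\<close> along the substitution \<open>x \<mapsto> x ^ c x\<close>, where \<open>c\<close> is the weight on \<open>U\<close> and 1
  elsewhere. On exponent vectors this says that \<open>m\<close> lies in \<open>I\<close> iff \<open>\<lfloor>m / c\<rfloor>\<close> lies in \<open>I'\<close>. For
  monomial ideals, powers, associated primes and contractions from localizations can all be described
  on exponent vectors, and each of these descriptions commutes with taking preimages under the
  surjection \<open>m \<mapsto> \<lfloor>m / c\<rfloor>\<close>. Hence the symbolic and ordinary powers of \<open>I\<close> are the preimages of
  those of \<open>I'\<close>, and one pair coincides iff the other does.
\<close>

section \<open>Localization at a multiplicative set\<close>

text \<open>The symbolic power is an intersection over all annihilator primes of the quotient, and
  nothing in the definition says that these are generated by variables. It suffices that each of
  them lies inside an associated prime generated by variables: a larger prime admits fewer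
  denominators, so its contraction is the smaller one, and the primes generated by variables already
  determine the intersection. The second obstacle is cancellation, since a monomial of a product may
  vanish although several pairs of factors contribute to it. For primality, associated primes and
  contractions one therefore selects monomials of both factors whose sums arise from no other pairs,
  and takes an extremal pair among them. Finite generation enters only as a bound on exponents
  beyond which a further factor of a variable does not affect membership.\<close>

text \<open>Collapses the unions over representatives in \<open>localization\<close> once the result
  is known to be independent of the representatives.\<close>

lemma UN_pairs_constant:
  assumes "(a, s) \<in> X" "(b, t) \<in> Y"
    and "\<And>a s b t. (a, s) \<in> X \<Longrightarrow> (b, t) \<in> Y \<Longrightarrow> F a s b t = c"
  shows "(\<Union>(a, s) \<in> X. \<Union>(b, t) \<in> Y. F a s b t) = c"
proof -
  have "(\<Union>(b, t) \<in> Y. F a s b t) = c" if "(a, s) \<in> X" for a s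
    by (rule UN_constant_eq[OF assms(2)]) (use assms(3) that in \<open>simp add: split_beta\<close>)
  then show ?thesis
    by (intro UN_constant_eq[OF assms(1)]) (simp add: split_beta)
qed

locale mult_closed = cring R for R (structure) +
  fixes S
  assumes S_carrier: "S \<subseteq> carrier R"
    and S_one: "\<one> \<in> S"
    and S_mult: "\<lbrakk>s \<in> S; t \<in> S\<rbrakk> \<Longrightarrow> s \<otimes> t \<in> S"
begin

lemma S_closed [simp, intro]: "s \<in> S \<Longrightarrow> s \<in> carrier R"
  using S_carrier by blast

text \<open>Trades the difference in \<open>frac_rel\<close> for an equation of products, a form in
  which witnesses can be multiplied together.\<close>

lemma frac_rel_iff:
  "((a, s), (b, t)) \<in> frac_rel R S \<longleftrightarrow>
    a \<in> carrier R \<and> b \<in> carrier R \<and> s \<in> S \<and> t \<in> S \<and> (\<exists>u\<in>S. u \<otimes> a \<otimes> t = u \<otimes> b \<otimes> s)"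
proof -
  have "u \<otimes> (a \<otimes> t \<ominus> b \<otimes> s) = \<zero> \<longleftrightarrow> u \<otimes> a \<otimes> t = u \<otimes> b \<otimes> s"
    if "a \<in> carrier R" "b \<in> carrier R" "s \<in> S" "t \<in> S" "u \<in> S" for u
  proof -
    have "u \<otimes> (a \<otimes> t \<ominus> b \<otimes> s) = u \<otimes> a \<otimes> t \<ominus> u \<otimes> b \<otimes> s"
      using that S_closed by algebra
    moreover have "u \<otimes> a \<otimes> t \<in> carrier R" "u \<otimes> b \<otimes> s \<in> carrier R"
      using that by auto
    ultimately show ?thesis
      by (metis a_minus_def minus_equality minus_minus r_neg a_inv_closed)
  qed
  then show ?thesis
    unfolding frac_rel_def by blast
qed

lemma equiv_frac_rel: "equiv (carrier R \<times> S) (frac_rel R S)"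
proof (rule equivI)
  show "frac_rel R S \<subseteq> (carrier R \<times> S) \<times> (carrier R \<times> S)"
    unfolding frac_rel_def by blast
  show "refl_on (carrier R \<times> S) (frac_rel R S)"
    using S_one by (auto simp: refl_on_def frac_rel_iff)
  show "sym (frac_rel R S)"
  proof (rule symI)
    fix x y assume "(x, y) \<in> frac_rel R S"
    then show "(y, x) \<in> frac_rel R S"
      by (cases x; cases y) (metis frac_rel_iff)
  qed
  show "trans (frac_rel R S)"
  proof (rule transI)
    fix x y z
    assume xy: "(x, y) \<in> frac_rel R S" and yz: "(y, z) \<in> frac_rel R S"
    obtain a s b t c r where x: "x = (a, s)" "y = (b, t)" "z = (c, r)"
      by (cases x; cases y; cases z) auto
    obtain u where u: "u \<in> S" "u \<otimes> a \<otimes> t = u \<otimes> b \<otimes> s"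
      using xy x by (auto simp: frac_rel_iff)
    obtain v where v: "v \<in> S" "v \<otimes> b \<otimes> r = v \<otimes> c \<otimes> t"
      using yz x by (auto simp: frac_rel_iff)
    have S: "a \<in> carrier R" "b \<in> carrier R" "c \<in> carrier R" "s \<in> S" "t \<in> S" "r \<in> S"
      using xy yz x by (auto simp: frac_rel_iff)
    have c: "s \<in> carrier R" "t \<in> carrier R" "r \<in> carrier R" "u \<in> carrier R" "v \<in> carrier R"
      using S u v by auto
    \<comment> \<open>The two witnesses alone do not suffice, because the middle denominator
      \<open>t\<close> cannot be cancelled; it becomes part of the new witness.\<close>
    have "(u \<otimes> v \<otimes> t) \<otimes> a \<otimes> r = (u \<otimes> a \<otimes> t) \<otimes> (v \<otimes> r)"
      using S(1-3) c by algebra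
    also have "\<dots> = (v \<otimes> b \<otimes> r) \<otimes> (u \<otimes> s)"
      unfolding u(2) using S(1-3) c by algebra
    also have "\<dots> = (u \<otimes> v \<otimes> t) \<otimes> c \<otimes> s"
      unfolding v(2) using S(1-3) c by algebra
    finally show "(x, z) \<in> frac_rel R S"
      using S u v x S_mult by (auto simp: frac_rel_iff)
  qed
qed

lemma frac_eq_iff:
  assumes "a \<in> carrier R" "b \<in> carrier R" "s \<in> S" "t \<in> S"
  shows "frac R S a s = frac R S b t \<longleftrightarrow> (\<exists>u\<in>S. u \<otimes> a \<otimes> t = u \<otimes> b \<otimes> s)"
  using eq_equiv_class_iff[OF equiv_frac_rel, of "(a, s)" "(b, t)"] assms
  by (simp add: frac_def frac_rel_iff)

lemma mem_frac_iff:
  assumes "a \<in> carrier R" "s \<in> S"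
  shows "(b, t) \<in> frac R S a s \<longleftrightarrow> b \<in> carrier R \<and> t \<in> S \<and> frac R S b t = frac R S a s"
proof -
  have "(b, t) \<in> frac R S a s \<longleftrightarrow> ((a, s), (b, t)) \<in> frac_rel R S"
    by (simp add: frac_def)
  then show ?thesis
    using assms frac_eq_iff[of a b s t] by (auto simp: frac_rel_iff)
qed

lemma localization_carrier_iff:
  "X \<in> carrier (localization R S) \<longleftrightarrow> (\<exists>a\<in>carrier R. \<exists>s\<in>S. X = frac R S a s)"
  by (auto simp: localization_def frac_def quotient_def)

lemma localization_carrierE [elim!]:
  assumes "X \<in> carrier (localization R S)"
  obtains a s where "a \<in> carrier R" "s \<in> S" "X = frac R S a s"
  using assms unfolding localization_carrier_iff by blast

lemma frac_closed [simp]: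
  "a \<in> carrier R \<Longrightarrow> s \<in> S \<Longrightarrow> frac R S a s \<in> carrier (localization R S)"
  by (auto simp: localization_carrier_iff)

lemma frac_mult [simp]:
  assumes "a \<in> carrier R" "s \<in> S" "b \<in> carrier R" "t \<in> S"
  shows "frac R S a s \<otimes>\<^bsub>localization R S\<^esub> frac R S b t = frac R S (a \<otimes> b) (s \<otimes> t)"
proof -
  have *: "frac R S (a' \<otimes> b') (s' \<otimes> t') = frac R S (a \<otimes> b) (s \<otimes> t)"
    if a: "(a', s') \<in> frac R S a s" and b: "(b', t') \<in> frac R S b t" for a' s' b' t'
  proof -
    have c: "a' \<in> carrier R" "s' \<in> S" "b' \<in> carrier R" "t' \<in> S"
      using a b assms by (auto simp: mem_frac_iff)
    obtain u where u: "u \<in> S" "u \<otimes> a' \<otimes> s = u \<otimes> a \<otimes> s'"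
      using a c assms by (auto simp: mem_frac_iff frac_eq_iff)
    obtain v where v: "v \<in> S" "v \<otimes> b' \<otimes> t = v \<otimes> b \<otimes> t'"
      using b c assms by (auto simp: mem_frac_iff frac_eq_iff)
    have c': "s \<in> carrier R" "t \<in> carrier R" "s' \<in> carrier R" "t' \<in> carrier R"
      "u \<in> carrier R" "v \<in> carrier R"
      using assms c u v by auto
    have "(u \<otimes> v) \<otimes> (a' \<otimes> b') \<otimes> (s \<otimes> t) = (u \<otimes> a' \<otimes> s) \<otimes> (v \<otimes> b' \<otimes> t)"
      using assms(1,3) c(1,3) c' by algebra
    also have "\<dots> = (u \<otimes> v) \<otimes> (a \<otimes> b) \<otimes> (s' \<otimes> t')"
      unfolding u(2) v(2) using assms(1,3) c(1,3) c' by algebra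
    finally show ?thesis
      using assms c u v S_mult by (auto simp: frac_eq_iff)
  qed
  have "(a, s) \<in> frac R S a s" "(b, t) \<in> frac R S b t"
    using assms by (auto simp: mem_frac_iff)
  then show ?thesis
    unfolding localization_def by (simp add: UN_pairs_constant[OF _ _ *])
qed

lemma frac_add [simp]:
  assumes "a \<in> carrier R" "s \<in> S" "b \<in> carrier R" "t \<in> S"
  shows "frac R S a s \<oplus>\<^bsub>localization R S\<^esub> frac R S b t =
    frac R S (a \<otimes> t \<oplus> b \<otimes> s) (s \<otimes> t)"
proof -
  have *: "frac R S (a' \<otimes> t' \<oplus> b' \<otimes> s') (s' \<otimes> t') = frac R S (a \<otimes> t \<oplus> b \<otimes> s) (s \<otimes> t)"
    if a: "(a', s') \<in> frac R S a s" and b: "(b', t') \<in> frac R S b t" for a' s' b' t'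
  proof -
    have c: "a' \<in> carrier R" "s' \<in> S" "b' \<in> carrier R" "t' \<in> S"
      using a b assms by (auto simp: mem_frac_iff)
    obtain u where u: "u \<in> S" "u \<otimes> a' \<otimes> s = u \<otimes> a \<otimes> s'"
      using a c assms by (auto simp: mem_frac_iff frac_eq_iff)
    obtain v where v: "v \<in> S" "v \<otimes> b' \<otimes> t = v \<otimes> b \<otimes> t'"
      using b c assms by (auto simp: mem_frac_iff frac_eq_iff)
    have c': "s \<in> carrier R" "t \<in> carrier R" "s' \<in> carrier R" "t' \<in> carrier R"
      "u \<in> carrier R" "v \<in> carrier R"
      using assms c u v by auto
    have "(u \<otimes> v) \<otimes> (a' \<otimes> t' \<oplus> b' \<otimes> s') \<otimes> (s \<otimes> t) =
        (u \<otimes> a' \<otimes> s) \<otimes> (v \<otimes> t \<otimes> t') \<oplus> (v \<otimes> b' \<otimes> t) \<otimes> (u \<otimes> s \<otimes> s')"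
      using assms(1,3) c(1,3) c' by algebra
    also have "\<dots> = (u \<otimes> v) \<otimes> (a \<otimes> t \<oplus> b \<otimes> s) \<otimes> (s' \<otimes> t')"
      unfolding u(2) v(2) using assms(1,3) c(1,3) c' by algebra
    finally show ?thesis
      using assms c u v S_mult by (auto simp: frac_eq_iff)
  qed
  have "(a, s) \<in> frac R S a s" "(b, t) \<in> frac R S b t"
    using assms by (auto simp: mem_frac_iff)
  then show ?thesis
    unfolding localization_def by (simp add: UN_pairs_constant[OF _ _ *])
qed

lemma localization_one: "\<one>\<^bsub>localization R S\<^esub> = frac R S \<one> \<one>"
  and localization_zero: "\<zero>\<^bsub>localization R S\<^esub> = frac R S \<zero> \<one>"
  by (simp_all add: localization_def)

lemma frac_eqI:
  assumes "a \<in> carrier R" "b \<in> carrier R" "s \<in> S" "t \<in> S" "a \<otimes> t = b \<otimes> s"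
  shows "frac R S a s = frac R S b t"
  using assms S_one by (auto simp: frac_eq_iff m_assoc intro!: bexI[of _ \<one>])

lemma frac_cancel:
  assumes "a \<in> carrier R" "s \<in> S" "r \<in> S"
  shows "frac R S (a \<otimes> r) (s \<otimes> r) = frac R S a s"
  using assms S_mult by (intro frac_eqI) (auto simp: m_ac)

lemma cring_localization: "cring (localization R S)"
proof (rule cringI)
  let ?L = "localization R S"
  note S_mult [simp] S_one [simp]
  show "abelian_group ?L"
  proof (rule abelian_groupI)
    show "x \<oplus>\<^bsub>?L\<^esub> y \<in> carrier ?L" if "x \<in> carrier ?L" "y \<in> carrier ?L" for x y
      using that by auto
    show "\<zero>\<^bsub>?L\<^esub> \<in> carrier ?L"
      by (simp add: localization_zero)
    show "x \<oplus>\<^bsub>?L\<^esub> y \<oplus>\<^bsub>?L\<^esub> z = x \<oplus>\<^bsub>?L\<^esub> (y \<oplus>\<^bsub>?L\<^esub> z)"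
      if xyz: "x \<in> carrier ?L" "y \<in> carrier ?L" "z \<in> carrier ?L" for x y z
    proof -
      obtain a s where x': "a \<in> carrier R" "s \<in> S" "x = frac R S a s"
        using xyz(1) by (rule localization_carrierE)
      obtain b t where y': "b \<in> carrier R" "t \<in> S" "y = frac R S b t"
        using xyz(2) by (rule localization_carrierE)
      obtain c r where z': "c \<in> carrier R" "r \<in> S" "z = frac R S c r"
        using xyz(3) by (rule localization_carrierE)
      note * = x'(1) y'(1) z'(1) x'(2) y'(2) z'(2) x'(3) y'(3) z'(3)
      have "s \<in> carrier R" "t \<in> carrier R" "r \<in> carrier R"
        using * by auto
      then have "(a \<otimes> t \<oplus> b \<otimes> s) \<otimes> r \<oplus> c \<otimes> (s \<otimes> t) =
          a \<otimes> (t \<otimes> r) \<oplus> (b \<otimes> r \<oplus> c \<otimes> t) \<otimes> s"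
        using *(1-3) by (simp add: l_distr r_distr m_ac a_ac)
      with * show ?thesis
        by (simp add: m_assoc)
    qed
    show "x \<oplus>\<^bsub>?L\<^esub> y = y \<oplus>\<^bsub>?L\<^esub> x" if xy: "x \<in> carrier ?L" "y \<in> carrier ?L" for x y
    proof -
      obtain a s where x': "a \<in> carrier R" "s \<in> S" "x = frac R S a s"
        using xy(1) by (rule localization_carrierE)
      obtain b t where y': "b \<in> carrier R" "t \<in> S" "y = frac R S b t"
        using xy(2) by (rule localization_carrierE)
      with x' show ?thesis
        by (simp add: a_comm m_comm S_closed)
    qed
    show "\<zero>\<^bsub>?L\<^esub> \<oplus>\<^bsub>?L\<^esub> x = x" if "x \<in> carrier ?L" for x
      using that by (auto simp: localization_zero)
    show "\<exists>y\<in>carrier ?L. y \<oplus>\<^bsub>?L\<^esub> x = \<zero>\<^bsub>?L\<^esub>" if x: "x \<in> carrier ?L" for x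
    proof -
      obtain a s where *: "a \<in> carrier R" "s \<in> S" "x = frac R S a s"
        using x by (rule localization_carrierE)
      have "s \<in> carrier R"
        using * by auto
      then have "(\<ominus> a) \<otimes> s \<oplus> a \<otimes> s = \<zero>"
        using *(1) by (simp add: l_minus l_neg)
      moreover have "frac R S \<zero> (s \<otimes> s) = frac R S \<zero> \<one>"
        using * by (intro frac_eqI) simp_all
      ultimately have "frac R S (\<ominus> a) s \<oplus>\<^bsub>?L\<^esub> x = \<zero>\<^bsub>?L\<^esub>"
        using * by (simp add: localization_zero)
      with * show ?thesis
        by (intro bexI[of _ "frac R S (\<ominus> a) s"]) simp_all
    qed
  qed
  show "comm_monoid ?L"
  proof (rule comm_monoidI)
    show "x \<otimes>\<^bsub>?L\<^esub> y \<in> carrier ?L" if "x \<in> carrier ?L" "y \<in> carrier ?L" for x y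
      using that by auto
    show "\<one>\<^bsub>?L\<^esub> \<in> carrier ?L"
      by (simp add: localization_one)
    show "x \<otimes>\<^bsub>?L\<^esub> y \<otimes>\<^bsub>?L\<^esub> z = x \<otimes>\<^bsub>?L\<^esub> (y \<otimes>\<^bsub>?L\<^esub> z)"
      if "x \<in> carrier ?L" "y \<in> carrier ?L" "z \<in> carrier ?L" for x y z
      using that by (auto simp: m_assoc)
    show "\<one>\<^bsub>?L\<^esub> \<otimes>\<^bsub>?L\<^esub> x = x" if "x \<in> carrier ?L" for x
      using that by (auto simp: localization_one)
    show "x \<otimes>\<^bsub>?L\<^esub> y = y \<otimes>\<^bsub>?L\<^esub> x" if "x \<in> carrier ?L" "y \<in> carrier ?L" for x y
      using that by (auto simp: m_comm)
  qed
  show "(x \<oplus>\<^bsub>?L\<^esub> y) \<otimes>\<^bsub>?L\<^esub> z = x \<otimes>\<^bsub>?L\<^esub> z \<oplus>\<^bsub>?L\<^esub> y \<otimes>\<^bsub>?L\<^esub> z"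
    if xyz: "x \<in> carrier ?L" "y \<in> carrier ?L" "z \<in> carrier ?L" for x y z
  proof -
    obtain a s where x': "a \<in> carrier R" "s \<in> S" "x = frac R S a s"
      using xyz(1) by (rule localization_carrierE)
    obtain b t where y': "b \<in> carrier R" "t \<in> S" "y = frac R S b t"
      using xyz(2) by (rule localization_carrierE)
    obtain c r where z': "c \<in> carrier R" "r \<in> S" "z = frac R S c r"
      using xyz(3) by (rule localization_carrierE)
    note * = x'(1) y'(1) z'(1) x'(2) y'(2) z'(2) x'(3) y'(3) z'(3)
    have "s \<in> carrier R" "t \<in> carrier R" "r \<in> carrier R"
      using * by auto
    \<comment> \<open>Adding the two products gives an extra factor \<open>r\<close> in numerator
      and denominator, which \<open>frac_cancel\<close> removes.\<close>
    then have "a \<otimes> c \<otimes> (t \<otimes> r) \<oplus> b \<otimes> c \<otimes> (s \<otimes> r) = (a \<otimes> t \<oplus> b \<otimes> s) \<otimes> c \<otimes> r"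
      "s \<otimes> r \<otimes> (t \<otimes> r) = s \<otimes> t \<otimes> r \<otimes> r"
      using *(1-3) by (simp_all add: l_distr r_distr m_ac)
    with * show ?thesis
      by (simp add: frac_cancel)
  qed
qed

text \<open>The fractions with a representative whose numerator is driven into \<open>J\<close> by some element of
  \<open>S\<close> form an ideal of the localization; it is the extension of \<open>J\<close>.\<close>

lemma frac_mem_extension_iff:
  assumes "ideal J R" "f \<in> carrier R"
  shows "frac R S f \<one> \<in> Idl\<^bsub>localization R S\<^esub> ((\<lambda>g. frac R S g \<one>) ` J)
    \<longleftrightarrow> (\<exists>u\<in>S. u \<otimes> f \<in> J)"
proof
  let ?L = "localization R S"
  interpret J: ideal J R by fact
  interpret L: cring ?L by (rule cring_localization)
  note S_mult [simp] S_one [simp]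
  have "(\<lambda>g. frac R S g \<one>) ` J \<subseteq> carrier ?L"
    by auto
  note gen = L.genideal_ideal[OF this] L.genideal_self[OF this]
  show "frac R S f \<one> \<in> Idl\<^bsub>?L\<^esub> ((\<lambda>g. frac R S g \<one>) ` J)" if ex: "\<exists>u\<in>S. u \<otimes> f \<in> J"
  proof -
    obtain u where u: "u \<in> S" "u \<otimes> f \<in> J"
      using ex by blast
    interpret K: ideal "Idl\<^bsub>?L\<^esub> ((\<lambda>g. frac R S g \<one>) ` J)" ?L by (rule gen(1))
    have "frac R S (u \<otimes> f) \<one> \<otimes>\<^bsub>?L\<^esub> frac R S \<one> u \<in> Idl\<^bsub>?L\<^esub> ((\<lambda>g. frac R S g \<one>) ` J)"
      using u gen(2) by (intro K.I_r_closed) auto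
    moreover have "frac R S (u \<otimes> f) \<one> \<otimes>\<^bsub>?L\<^esub> frac R S \<one> u = frac R S f \<one>"
      using u assms(2) frac_cancel[of f \<one> u] by (simp add: m_comm)
    ultimately show ?thesis
      by simp
  qed
  define K where "K = {X. \<exists>a\<in>carrier R. \<exists>s\<in>S. X = frac R S a s \<and> (\<exists>u\<in>S. u \<otimes> a \<in> J)}"
  have K_I: "frac R S a s \<in> K" if "a \<in> carrier R" "s \<in> S" "u \<in> S" "u \<otimes> a \<in> J" for a s u
    unfolding K_def using that by blast
  have K_E: thesis if "X \<in> K"
    "\<And>a s u. a \<in> carrier R \<Longrightarrow> s \<in> S \<Longrightarrow> X = frac R S a s \<Longrightarrow> u \<in> S \<Longrightarrow> u \<otimes> a \<in> J \<Longrightarrow> thesis" for X thesis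
    using that unfolding K_def by blast
  have "ideal K ?L"
  proof (rule idealI)
    show "ring ?L" ..
    have K_mult: "x \<otimes>\<^bsub>?L\<^esub> k \<in> K" if k: "k \<in> K" and x: "x \<in> carrier ?L" for k x
    proof -
      obtain a s u where a: "a \<in> carrier R" "s \<in> S" "k = frac R S a s" "u \<in> S" "u \<otimes> a \<in> J"
        using k by (rule K_E)
      obtain b t where b: "b \<in> carrier R" "t \<in> S" "x = frac R S b t"
        using x by (rule localization_carrierE)
      have "u \<otimes> (b \<otimes> a) = b \<otimes> (u \<otimes> a)"
        using a b by (simp add: m_lcomm)
      then have "u \<otimes> (b \<otimes> a) \<in> J"
        using a b by (simp add: J.I_l_closed)
      moreover have "x \<otimes>\<^bsub>?L\<^esub> k = frac R S (b \<otimes> a) (t \<otimes> s)"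
        using a b by simp
      ultimately show ?thesis
        using a b by (simp add: K_I[of _ _ u])
    qed
    then show "k \<in> K \<Longrightarrow> x \<in> carrier ?L \<Longrightarrow> x \<otimes>\<^bsub>?L\<^esub> k \<in> K" for k x .
    have K_carrier: "K \<subseteq> carrier ?L"
      by (auto simp: K_def)
    then show "k \<in> K \<Longrightarrow> x \<in> carrier ?L \<Longrightarrow> k \<otimes>\<^bsub>?L\<^esub> x \<in> K" for k x
      using K_mult[of k x] L.m_comm[of x k] by auto
    have "frac R S \<zero> \<one> \<in> K"
      by (rule K_I[of _ _ \<one>]) simp_all
    moreover have "x \<oplus>\<^bsub>?L\<^esub> y \<in> K" if x: "x \<in> K" and y: "y \<in> K" for x y
    proof -
      obtain a s u where a: "a \<in> carrier R" "s \<in> S" "x = frac R S a s" "u \<in> S" "u \<otimes> a \<in> J"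
        using x by (rule K_E)
      obtain b t v where b: "b \<in> carrier R" "t \<in> S" "y = frac R S b t" "v \<in> S" "v \<otimes> b \<in> J"
        using y by (rule K_E)
      have c: "s \<in> carrier R" "t \<in> carrier R" "u \<in> carrier R" "v \<in> carrier R"
        using a b by auto
      then have "(u \<otimes> v) \<otimes> (a \<otimes> t \<oplus> b \<otimes> s) = (v \<otimes> t) \<otimes> (u \<otimes> a) \<oplus> (u \<otimes> s) \<otimes> (v \<otimes> b)"
        using a(1) b(1) by algebra
      then have "(u \<otimes> v) \<otimes> (a \<otimes> t \<oplus> b \<otimes> s) \<in> J"
        using a b c by (simp add: J.I_l_closed)
      moreover have "x \<oplus>\<^bsub>?L\<^esub> y = frac R S (a \<otimes> t \<oplus> b \<otimes> s) (s \<otimes> t)"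
        using a b by simp
      ultimately show ?thesis
        using a b by (simp add: K_I[of _ _ "u \<otimes> v"])
    qed
    moreover have "\<ominus>\<^bsub>?L\<^esub> x \<in> K" if x: "x \<in> K" for x
      using K_mult[OF x, of "\<ominus>\<^bsub>?L\<^esub> \<one>\<^bsub>?L\<^esub>"] x K_carrier by (auto simp: L.l_minus)
    ultimately show "subgroup K (add_monoid ?L)"
      using K_carrier by (intro subgroup.intro) (auto simp: a_inv_def simp flip: localization_zero)
  qed
  moreover have "(\<lambda>g. frac R S g \<one>) ` J \<subseteq> K"
    by (auto intro!: K_I[of _ _ \<one>])
  ultimately have sub: "Idl\<^bsub>?L\<^esub> ((\<lambda>g. frac R S g \<one>) ` J) \<subseteq> K"
    by (rule L.genideal_minimal)
  show "\<exists>u\<in>S. u \<otimes> f \<in> J" if "frac R S f \<one> \<in> Idl\<^bsub>?L\<^esub> ((\<lambda>g. frac R S g \<one>) ` J)"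
  proof -
    have "frac R S f \<one> \<in> K"
      using that sub by blast
    then obtain a s u where a: "a \<in> carrier R" "s \<in> S" "frac R S f \<one> = frac R S a s" "u \<in> S"
        "u \<otimes> a \<in> J"
      by (rule K_E)
    obtain v where v: "v \<in> S" "v \<otimes> f \<otimes> s = v \<otimes> a \<otimes> \<one>"
      using a assms(2) by (auto simp: frac_eq_iff)
    have c: "s \<in> carrier R" "u \<in> carrier R" "v \<in> carrier R"
      using a v by auto
    have "(u \<otimes> v \<otimes> s) \<otimes> f = u \<otimes> (v \<otimes> f \<otimes> s)"
      using assms(2) a(1) c by algebra
    also have "\<dots> = v \<otimes> (u \<otimes> a)"
      unfolding v(2) using assms(2) a(1) c by algebra
    finally have "(u \<otimes> v \<otimes> s) \<otimes> f \<in> J"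
      using a c by (simp add: J.I_l_closed)
    with a v show ?thesis
      by (intro bexI[of _ "u \<otimes> v \<otimes> s"]) simp_all
  qed
qed

end

text \<open>The only access to localizations from here on: a fraction-free description by
  multipliers outside the prime.\<close>

lemma local_contraction_prime:
  fixes R (structure)
  assumes "primeideal P R" "ideal J R"
  shows "local_contraction R P J = {f \<in> carrier R. \<exists>u \<in> carrier R - P. u \<otimes> f \<in> J}"
proof -
  interpret P: primeideal P R by fact
  interpret mult_closed R "carrier R - P"
  proof
    show "\<one> \<in> carrier R - P"
      using P.I_notcarr P.one_imp_carrier by auto
    show "s \<otimes> t \<in> carrier R - P" if "s \<in> carrier R - P" "t \<in> carrier R - P" for s t
      using that P.I_prime by auto
  qed simp
  show ?thesis
    unfolding local_contraction_def using frac_mem_extension_iff[OF assms(2)] by auto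
qed

section \<open>Monomial ideals\<close>

abbreviation keys where "keys \<equiv> Poly_Mapping.keys"
abbreviation lookup where "lookup \<equiv> Poly_Mapping.lookup"
abbreviation single where "single \<equiv> Poly_Mapping.single"

definition exps :: "'v set \<Rightarrow> ('v \<Rightarrow>\<^sub>0 nat) set" where
  "exps V = {m. keys m \<subseteq> V}"

text \<open>One encoding serves for the carrier of the ring, for monomial ideals and for primes
  generated by variables.\<close>

definition span_monos :: "'a set \<Rightarrow> ('a \<Rightarrow>\<^sub>0 'k::zero) set" where
  "span_monos E = {f. keys f \<subseteq> E}"

lemma keys_add_nat: "keys (m + n) = keys m \<union> keys n" for m n :: "'v \<Rightarrow>\<^sub>0 nat"
  by (auto simp: in_keys_iff lookup_add)

lemma zero_in_exps [simp]: "0 \<in> exps V"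
  by (simp add: exps_def)

lemma add_in_exps_iff [simp]: "m + n \<in> exps V \<longleftrightarrow> m \<in> exps V \<and> n \<in> exps V"
  by (simp add: exps_def keys_add_nat)

lemma single_in_exps [simp]: "v \<in> V \<Longrightarrow> single v k \<in> exps V"
  by (simp add: exps_def)

lemma sum_in_exps: "(\<And>i. i \<in> I \<Longrightarrow> m i \<in> exps V) \<Longrightarrow> sum m I \<in> exps V"
  by (induction I rule: infinite_finite_induct) auto

lemma poly_mapping_sum_single: "f = (\<Sum>m\<in>keys f. single m (lookup f m))"
proof (rule poly_mapping_eqI)
  fix k
  show "lookup f k = lookup (\<Sum>m\<in>keys f. single m (lookup f m)) k"
    by (auto simp: lookup_sum lookup_single when_def in_keys_iff)
qed

text \<open>A finite double sum over the supports makes it visible which pairs contribute to a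
  coefficient and could cancel.\<close>

lemma lookup_times:
  "lookup (f * g) k = (\<Sum>p\<in>keys f. \<Sum>q\<in>keys g. if p + q = k then lookup f p * lookup g q else 0)"
  for f g :: "'a::comm_monoid_add \<Rightarrow>\<^sub>0 'k::comm_semiring_1"
proof -
  have "f * g = (\<Sum>p\<in>keys f. single p (lookup f p)) * (\<Sum>q\<in>keys g. single q (lookup g q))"
    using poly_mapping_sum_single[of f] poly_mapping_sum_single[of g] by simp
  also have "\<dots> = (\<Sum>p\<in>keys f. \<Sum>q\<in>keys g. single (p + q) (lookup f p * lookup g q))"
    by (simp add: sum_product mult_single)
  finally show ?thesis
    by (simp add: lookup_sum lookup_single when_def)
qed

lemma lookup_single_times:
  "lookup (single m c * f) (m + n) = c * lookup f n"
  for f :: "('v \<Rightarrow>\<^sub>0 nat) \<Rightarrow>\<^sub>0 'k::field"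
proof (cases "c = 0")
  case False
  then have "lookup (single m c * f) (m + n) = (\<Sum>q\<in>keys f. if q = n then c * lookup f q else 0)"
    by (simp add: lookup_times)
  then show ?thesis
    by (simp add: in_keys_iff)
qed simp

lemma keys_single_times:
  fixes f :: "('v \<Rightarrow>\<^sub>0 nat) \<Rightarrow>\<^sub>0 'k::field"
  assumes "c \<noteq> 0"
  shows "keys (single m c * f) = (+) m ` keys f"
proof
  show "keys (single m c * f) \<subseteq> (+) m ` keys f"
    using keys_mult[of "single m c" f] assms by auto
  show "(+) m ` keys f \<subseteq> keys (single m c * f)"
    using assms by (auto simp: in_keys_iff lookup_single_times)
qed

section \<open>The polynomial ring and polynomials supported in a set of exponents\<close>

lemma mpoly_ring_simps [simp]:
  "carrier (mpoly_ring V) = span_monos (exps V)"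
  "mult (mpoly_ring V) = (*)" "one (mpoly_ring V) = 1"
  "zero (mpoly_ring V) = 0" "add (mpoly_ring V) = (+)"
  by (auto simp: mpoly_ring_def span_monos_def exps_def)

lemma span_monos_add: "f \<in> span_monos E \<Longrightarrow> g \<in> span_monos E \<Longrightarrow> f + g \<in> span_monos E"
  using keys_add[of f g] by (auto simp: span_monos_def)

lemma span_monos_uminus: "f \<in> span_monos E \<Longrightarrow> - f \<in> span_monos E"
  for f :: "'a \<Rightarrow>\<^sub>0 'k::ab_group_add"
  by (auto simp: span_monos_def in_keys_iff)

lemma span_monos_zero [simp]: "0 \<in> span_monos E"
  by (simp add: span_monos_def)

lemma span_monos_single: "m \<in> E \<Longrightarrow> single m c \<in> span_monos E"
  by (simp add: span_monos_def)

lemma single_mem_span_monos_iff: "c \<noteq> 0 \<Longrightarrow> single m c \<in> span_monos E \<longleftrightarrow> m \<in> E"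
  by (simp add: span_monos_def)

lemma span_monos_mult:
  assumes "f \<in> span_monos E" "g \<in> span_monos F" "\<And>m n. m \<in> E \<Longrightarrow> n \<in> F \<Longrightarrow> m + n \<in> G"
  shows "f * g \<in> span_monos G"
  using assms keys_mult[of f g] by (fastforce simp: span_monos_def)

text \<open>Monomials with coefficient 1 test membership, so equality of ideals can be decided on
  exponents.\<close>

lemma span_monos_eq_iff:
  "(span_monos E :: ('a \<Rightarrow>\<^sub>0 'k::zero_neq_one) set) = span_monos F \<longleftrightarrow> E = F"
proof
  assume eq: "(span_monos E :: ('a \<Rightarrow>\<^sub>0 'k) set) = span_monos F"
  have "m \<in> E \<longleftrightarrow> m \<in> F" for m
    using single_mem_span_monos_iff[of "1::'k" m E] single_mem_span_monos_iff[of "1::'k" m F] eq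
    by simp
  then show "E = F"
    by blast
qed simp

lemma cring_mpoly_ring: "cring (mpoly_ring V :: ('v, 'k::field) mpoly ring)"
proof (rule cringI)
  show "abelian_group (mpoly_ring V :: ('v, 'k) mpoly ring)"
  proof (rule abelian_groupI)
    show "\<exists>y\<in>carrier (mpoly_ring V). y \<oplus>\<^bsub>mpoly_ring V\<^esub> x = \<zero>\<^bsub>mpoly_ring V\<^esub>"
      if "x \<in> carrier (mpoly_ring V)" for x :: "('v, 'k) mpoly"
      using that span_monos_uminus[of x] by (intro bexI[of _ "- x"]) auto
  qed (auto simp: span_monos_add add_ac)
  show "comm_monoid (mpoly_ring V :: ('v, 'k) mpoly ring)"
  proof (rule comm_monoidI)
    show "x \<otimes>\<^bsub>mpoly_ring V\<^esub> y \<in> carrier (mpoly_ring V)"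
      if "x \<in> carrier (mpoly_ring V)" "y \<in> carrier (mpoly_ring V)" for x y :: "('v, 'k) mpoly"
      using that span_monos_mult[of x "exps V" y "exps V"] by simp
  qed (auto simp: mult_ac span_monos_def)
qed (auto simp: algebra_simps)

text \<open>These are the ideals of the monoid \<open>exps V\<close>. The empty set is allowed; it
  gives the zero ideal, as for a graph without edges.\<close>

definition exp_ideal :: "'v set \<Rightarrow> ('v \<Rightarrow>\<^sub>0 nat) set \<Rightarrow> bool" where
  "exp_ideal V E \<longleftrightarrow> E \<subseteq> exps V \<and> (\<forall>m\<in>E. \<forall>n\<in>exps V. m + n \<in> E)"

lemma exp_idealD:
  assumes "exp_ideal V E"
  shows "E \<subseteq> exps V" "m \<in> E \<Longrightarrow> m \<in> exps V"
    and "m \<in> E \<Longrightarrow> n \<in> exps V \<Longrightarrow> m + n \<in> E" "m \<in> E \<Longrightarrow> n \<in> exps V \<Longrightarrow> n + m \<in> E"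
  using assms by (auto simp: exp_ideal_def add.commute)

lemma ideal_span_monos:
  assumes "exp_ideal V E"
  shows "ideal (span_monos E :: ('v, 'k::field) mpoly set) (mpoly_ring V)"
proof (rule idealI)
  interpret cring "mpoly_ring V :: ('v, 'k) mpoly ring" by (rule cring_mpoly_ring)
  show "ring (mpoly_ring V :: ('v, 'k) mpoly ring)" ..
  have sub: "span_monos E \<subseteq> (span_monos (exps V) :: ('v, 'k) mpoly set)"
    using assms by (auto simp: span_monos_def exp_ideal_def)
  have "- x = inv\<^bsub>add_monoid (mpoly_ring V)\<^esub> x" if "x \<in> span_monos E" for x :: "('v, 'k) mpoly"
    using that sub span_monos_uminus[of x] minus_equality[of "- x" x] unfolding a_inv_def by auto
  then have "inv\<^bsub>add_monoid (mpoly_ring V)\<^esub> x \<in> span_monos E"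
    if "x \<in> span_monos E" for x :: "('v, 'k) mpoly"
    using that span_monos_uminus[of x] by metis
  then show "subgroup (span_monos E :: ('v, 'k) mpoly set) (add_monoid (mpoly_ring V))"
    using sub by (intro subgroup.intro) (auto simp: span_monos_add)
  show "x \<otimes>\<^bsub>mpoly_ring V\<^esub> a \<in> span_monos E"
    if "a \<in> span_monos E" "x \<in> carrier (mpoly_ring V)" for a x :: "('v, 'k) mpoly"
    using span_monos_mult[of x "exps V" a E E] that exp_idealD[OF assms] by auto
  show "a \<otimes>\<^bsub>mpoly_ring V\<^esub> x \<in> span_monos E"
    if "a \<in> span_monos E" "x \<in> carrier (mpoly_ring V)" for a x :: "('v, 'k) mpoly"
    using span_monos_mult[of a E x "exps V" E] that exp_idealD[OF assms] by auto
qed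

section \<open>Products, powers and generators of monomial ideals\<close>

definition exp_sum :: "('v \<Rightarrow>\<^sub>0 nat) set \<Rightarrow> ('v \<Rightarrow>\<^sub>0 nat) set \<Rightarrow> ('v \<Rightarrow>\<^sub>0 nat) set" where
  "exp_sum E F = {m + n |m n. m \<in> E \<and> n \<in> F}"

lemma exp_ideal_exp_sum:
  assumes "exp_ideal V E" "exp_ideal V F"
  shows "exp_ideal V (exp_sum E F)"
  unfolding exp_ideal_def
proof (intro conjI ballI)
  show "exp_sum E F \<subseteq> exps V"
    using assms by (auto simp: exp_sum_def dest: exp_idealD)
  fix k n assume "k \<in> exp_sum E F" "n \<in> exps V"
  then obtain a b where "k = a + b" "a \<in> E" "b + n \<in> F"
    using assms by (auto simp: exp_sum_def dest: exp_idealD)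
  then show "k + n \<in> exp_sum E F"
    unfolding exp_sum_def by (auto simp: add.assoc)
qed

text \<open>A term with exponent \<open>a + b\<close> splits into two monomials, one of which takes
  the coefficient; every polynomial is the sum of its terms.\<close>

lemma ideal_prod_span_monos:
  assumes "exp_ideal V E" "exp_ideal V F"
  shows "ideal_prod (mpoly_ring V) (span_monos E) (span_monos F) =
    (span_monos (exp_sum E F) :: ('v, 'k::field) mpoly set)" (is "?P = _")
proof
  show "?P \<subseteq> span_monos (exp_sum E F)"
  proof
    fix f assume "f \<in> ?P"
    then show "f \<in> span_monos (exp_sum E F)"
    proof induction
      case (prod i j)
      then show ?case
        using span_monos_mult[of i E j F "exp_sum E F"] by (auto simp: exp_sum_def)
    qed (simp add: span_monos_add)
  qed
  interpret cring "mpoly_ring V :: ('v, 'k) mpoly ring" by (rule cring_mpoly_ring)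
  interpret P: ideal ?P "mpoly_ring V"
    using assms by (intro ideal_prod_is_ideal ideal_span_monos)
  have P_sum: "sum f I \<in> ?P" if "\<And>i. i \<in> I \<Longrightarrow> f i \<in> ?P"
    for I :: "('v \<Rightarrow>\<^sub>0 nat) set" and f
    using that P.a_closed P.zero_closed
    by (induction I rule: infinite_finite_induct) auto
  show "span_monos (exp_sum E F) \<subseteq> ?P"
  proof
    fix f :: "('v, 'k) mpoly" assume f: "f \<in> span_monos (exp_sum E F)"
    have "single m (lookup f m) \<in> ?P" if m: "m \<in> keys f" for m
    proof -
      obtain a b where "m = a + b" "a \<in> E" "b \<in> F"
        using f m by (auto simp: span_monos_def exp_sum_def)
      then show ?thesis
        using ideal_prod.prod[of "single a (lookup f m)" "span_monos E" "single b 1" "span_monos F"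
            "mpoly_ring V"]
        by (simp add: span_monos_single mult_single)
    qed
    then show "f \<in> ?P"
      using P_sum[of "keys f" "\<lambda>m. single m (lookup f m)"] poly_mapping_sum_single[of f] by simp
  qed
qed

text \<open>Mirrors \<open>[^]\<close> in the monoid of ideals: the unit is the whole ring, and each
  new factor is on the right.\<close>

primrec exp_power :: "'v set \<Rightarrow> ('v \<Rightarrow>\<^sub>0 nat) set \<Rightarrow> nat \<Rightarrow> ('v \<Rightarrow>\<^sub>0 nat) set" where
  "exp_power V E 0 = exps V"
| "exp_power V E (Suc s) = exp_sum (exp_power V E s) E"

lemma exp_ideal_exp_power: "exp_ideal V E \<Longrightarrow> exp_ideal V (exp_power V E s)"
  by (induction s) (auto simp: exp_ideal_exp_sum, simp add: exp_ideal_def)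

lemma ideal_power_span_monos:
  assumes "exp_ideal V E"
  shows "ideal_power (mpoly_ring V) (span_monos E) s =
    (span_monos (exp_power V E s) :: ('v, 'k::field) mpoly set)"
proof (induction s)
  case 0
  then show ?case
    by (simp add: ideal_power_def nat_pow_def ideals_set_def)
next
  case (Suc s)
  have "ideal_power (mpoly_ring V) (span_monos E) (Suc s) = ideal_prod (mpoly_ring V)
      (ideal_power (mpoly_ring V) (span_monos E) s) (span_monos E :: ('v, 'k) mpoly set)"
    by (simp add: ideal_power_def nat_pow_def ideals_set_def)
  then show ?case
    using Suc ideal_prod_span_monos[OF exp_ideal_exp_power[OF assms] assms] by simp
qed

definition up_closure :: "'v set \<Rightarrow> ('v \<Rightarrow>\<^sub>0 nat) set \<Rightarrow> ('v \<Rightarrow>\<^sub>0 nat) set" where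
  "up_closure V G = {g + n |g n. g \<in> G \<and> n \<in> exps V}"

lemma exp_ideal_up_closure: "G \<subseteq> exps V \<Longrightarrow> exp_ideal V (up_closure V G)"
  unfolding exp_ideal_def up_closure_def by (fastforce simp: add.assoc)

lemma genideal_monomials:
  assumes "G \<subseteq> exps V"
  shows "Idl\<^bsub>mpoly_ring V\<^esub> ((\<lambda>g. single g 1) ` G) =
    (span_monos (up_closure V G) :: ('v, 'k::field) mpoly set)" (is "?I = _")
proof
  interpret cring "mpoly_ring V :: ('v, 'k) mpoly ring" by (rule cring_mpoly_ring)
  have sub: "(\<lambda>g. single g 1) ` G \<subseteq> (carrier (mpoly_ring V) :: ('v, 'k) mpoly set)"
    using assms by (auto simp: span_monos_single)
  have "G \<subseteq> up_closure V G"
    by (force simp: up_closure_def)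
  then show "?I \<subseteq> span_monos (up_closure V G)"
    using assms by (intro genideal_minimal ideal_span_monos exp_ideal_up_closure)
      (auto simp: span_monos_single)
  interpret I: ideal ?I "mpoly_ring V"
    by (rule genideal_ideal[OF sub])
  have I_sum: "sum f J \<in> ?I" if "\<And>i. i \<in> J \<Longrightarrow> f i \<in> ?I"
    for J :: "('v \<Rightarrow>\<^sub>0 nat) set" and f
    using that I.a_closed I.zero_closed
    by (induction J rule: infinite_finite_induct) auto
  show "span_monos (up_closure V G) \<subseteq> ?I"
  proof
    fix f :: "('v, 'k) mpoly" assume f: "f \<in> span_monos (up_closure V G)"
    have "single m (lookup f m) \<in> ?I" if m: "m \<in> keys f" for m
    proof -
      obtain g n where g: "m = g + n" "g \<in> G" "n \<in> exps V"
        using f m by (auto simp: span_monos_def up_closure_def)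
      then have "single g 1 \<in> ?I"
        using genideal_self[OF sub] by auto
      then show ?thesis
        using I.I_r_closed[of "single g 1" "single n (lookup f m)"] g
        by (simp add: span_monos_single mult_single)
    qed
    then show "f \<in> ?I"
      using I_sum[of "keys f" "\<lambda>m. single m (lookup f m)"] poly_mapping_sum_single[of f] by simp
  qed
qed

section \<open>Associated primes and symbolic powers of monomial ideals\<close>

text \<open>The smallest elements for a monomial order have this property; the order is obtained by
  numbering the variables.\<close>

lemma ex_unique_sum_decomposition:
  assumes "finite V" "finite X" "X \<noteq> {}" "X \<subseteq> exps V" "finite Y" "Y \<noteq> {}" "Y \<subseteq> exps V"
  shows "\<exists>p\<in>X. \<exists>q\<in>Y. \<forall>p'\<in>X. \<forall>q'\<in>Y. p' + q' = p + q \<longrightarrow> p' = p \<and> q' = q"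
proof -
  obtain idx :: "'a \<Rightarrow> nat" where idx: "inj_on idx V"
    using finite_imp_inj_to_nat_seg[OF assms(1)] by blast
  \<comment> \<open>Exponents indexed by \<open>nat\<close> have a linear order with strictly
    monotone addition, whereas \<open>'a\<close> carries no order. As \<open>key\<close> is additive
    and injective on \<open>exps V\<close>, it transports that order.\<close>
  define key :: "('a \<Rightarrow>\<^sub>0 nat) \<Rightarrow> (nat \<Rightarrow>\<^sub>0 nat)" where
    "key m = (\<Sum>v\<in>V. single (idx v) (lookup m v))" for m
  have key_add: "key (m + n) = key m + key n" for m n
    by (simp add: key_def lookup_add single_add sum.distrib)
  have lookup_key: "lookup (key m) (idx v) = lookup m v" if "v \<in> V" for m v
  proof -
    have "lookup (key m) (idx v) = (\<Sum>w\<in>V. if w = v then lookup m w else 0)"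
      unfolding key_def lookup_sum using idx that
      by (intro sum.cong) (auto simp: lookup_single when_def inj_on_eq_iff)
    then show ?thesis
      using that assms(1) by simp
  qed
  have key_inj: "m = n" if "key m = key n" "m \<in> exps V" "n \<in> exps V" for m n
  proof (rule poly_mapping_eqI)
    fix v
    show "lookup m v = lookup n v"
      using that lookup_key[of v m] lookup_key[of v n]
      by (cases "v \<in> V") (auto simp: exps_def in_keys_iff subset_iff, metis neq0_conv)
  qed
  have "Min (key ` X) \<in> key ` X" "Min (key ` Y) \<in> key ` Y"
    using assms by simp_all
  then obtain p q where pq: "p \<in> X" "q \<in> Y" "key p = Min (key ` X)" "key q = Min (key ` Y)"
    by auto
  have "p' = p \<and> q' = q" if "p' \<in> X" "q' \<in> Y" "p' + q' = p + q" for p' q'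
  proof -
    have "key p \<le> key p'" "key q \<le> key q'"
      using pq that assms by simp_all
    moreover have "key p' + key q' = key p + key q"
      using that key_add by metis
    ultimately have "key p' = key p" "key q' = key q"
      by (metis add_less_le_mono add_le_less_mono order.strict_iff_order order.irrefl)+
    then show ?thesis
      using key_inj that pq assms by blast
  qed
  with pq show ?thesis
    by blast
qed

text \<open>The device against cancellation. By \<open>XY\<close>, a sum from \<open>X\<close> and
  \<open>Y\<close> receives contributions only from pairs in \<open>X\<close> and \<open>Y\<close>;
  a sum with a unique decomposition there then has the product of two nonzero coefficients as its
  coefficient.\<close>

lemma ex_add_mem_keys_mult:
  fixes f g :: "('v, 'k::field) mpoly"
  assumes "finite V" "keys f \<subseteq> exps V" "keys g \<subseteq> exps V"
    and X: "X \<subseteq> keys f" "X \<noteq> {}" and Y: "Y \<subseteq> keys g" "Y \<noteq> {}"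
    and XY: "\<And>p q p' q'. \<lbrakk>p \<in> X; q \<in> Y; p' \<in> keys f; q' \<in> keys g; p' + q' = p + q\<rbrakk>
      \<Longrightarrow> p' \<in> X \<and> q' \<in> Y"
  shows "\<exists>p\<in>X. \<exists>q\<in>Y. p + q \<in> keys (f * g)"
proof -
  have "finite X" "finite Y"
    using X Y by (auto intro: finite_subset[OF _ finite_keys])
  then obtain p q where pq: "p \<in> X" "q \<in> Y"
    and uniq: "\<And>p' q'. \<lbrakk>p' \<in> X; q' \<in> Y; p' + q' = p + q\<rbrakk> \<Longrightarrow> p' = p \<and> q' = q"
    using ex_unique_sum_decomposition[of V X Y] assms by (metis subset_trans)
  have "(if p' + q' = p + q then lookup f p' * lookup g q' else 0) =
      (if q' = q then if p' = p then lookup f p * lookup g q else 0 else 0)"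
    if "p' \<in> keys f" "q' \<in> keys g" for p' q'
    using uniq[of p' q'] XY[OF pq that] by auto
  then have "lookup (f * g) (p + q) =
      (\<Sum>p'\<in>keys f. \<Sum>q'\<in>keys g. if q' = q then if p' = p then lookup f p * lookup g q else 0 else 0)"
    unfolding lookup_times by (intro sum.cong refl) auto
  also have "\<dots> = lookup f p * lookup g q"
    using pq X Y by (simp add: subset_iff)
  finally have "p + q \<in> keys (f * g)"
    using pq X Y by (auto simp: in_keys_iff)
  with pq show ?thesis
    by blast
qed

section \<open>Annihilator primes and primes generated by variables\<close>

lemma mem_assoc_primes_iff:
  fixes R (structure)
  assumes "cring R" "ideal I R"
  shows "P \<in> assoc_primes R I \<longleftrightarrow>
    primeideal P R \<and> (\<exists>f\<in>carrier R. P = {r \<in> carrier R. r \<otimes> f \<in> I})"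
proof -
  interpret cring R by fact
  interpret I: ideal I R by fact
  have zero: "(I +> r) \<otimes>\<^bsub>R Quot I\<^esub> (I +> f) = \<zero>\<^bsub>R Quot I\<^esub> \<longleftrightarrow> r \<otimes> f \<in> I"
    if rf: "r \<in> carrier R" "f \<in> carrier R" for r f
  proof -
    have "(I +> r) \<otimes>\<^bsub>R Quot I\<^esub> (I +> f) = I +> (r \<otimes> f)" "\<zero>\<^bsub>R Quot I\<^esub> = I"
      using I.rcoset_mult_add[OF rf] by (simp_all add: FactRing_def)
    then show ?thesis
      using I.a_rcos_const I.rcos_const_imp_mem m_closed[OF rf] by metis
  qed
  have carr: "m \<in> carrier (R Quot I) \<longleftrightarrow> (\<exists>f\<in>carrier R. m = I +> f)" for m
    by (auto simp: FactRing_simps)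
  have "(\<exists>m\<in>carrier (R Quot I). P = {r \<in> carrier R. (I +> r) \<otimes>\<^bsub>R Quot I\<^esub> m = \<zero>\<^bsub>R Quot I\<^esub>}) \<longleftrightarrow>
      (\<exists>f\<in>carrier R. P = {r \<in> carrier R. (I +> r) \<otimes>\<^bsub>R Quot I\<^esub> (I +> f) = \<zero>\<^bsub>R Quot I\<^esub>})"
    unfolding Bex_def carr by blast
  also have "\<dots> \<longleftrightarrow> (\<exists>f\<in>carrier R. P = {r \<in> carrier R. r \<otimes> f \<in> I})"
    by (simp add: zero cong: conj_cong)
  finally show ?thesis
    unfolding assoc_primes_def by blast
qed

text \<open>The ideal generated by the variables in \<open>A \<inter> V\<close>: its monomials are
  those divisible by one of these variables.\<close>

definition mono_prime :: "'v set \<Rightarrow> 'v set \<Rightarrow> ('v, 'k::field) mpoly set" where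
  "mono_prime V A = span_monos {m \<in> exps V. keys m \<inter> A \<noteq> {}}"

lemma mem_mono_prime_iff:
  "f \<in> mono_prime V A \<longleftrightarrow> f \<in> span_monos (exps V) \<and> (\<forall>m\<in>keys f. keys m \<inter> A \<noteq> {})"
  by (auto simp: mono_prime_def span_monos_def)

text \<open>A sum of exponents avoids \<open>A\<close> only if both summands do. Hence the monomials
  of two factors that avoid \<open>A\<close> interfere with no others, and one of their products
  survives.\<close>

lemma primeideal_mono_prime:
  assumes "finite V"
  shows "primeideal (mono_prime V A :: ('v, 'k::field) mpoly set) (mpoly_ring V)"
proof (rule primeidealI)
  show "cring (mpoly_ring V :: ('v, 'k) mpoly ring)"
    by (rule cring_mpoly_ring)
  show "ideal (mono_prime V A :: ('v, 'k) mpoly set) (mpoly_ring V)"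
    unfolding mono_prime_def
    by (rule ideal_span_monos) (auto simp: exp_ideal_def keys_add_nat)
  have "(1 :: ('v, 'k) mpoly) \<in> carrier (mpoly_ring V)" "(1 :: ('v, 'k) mpoly) \<notin> mono_prime V A"
    by (auto simp: mem_mono_prime_iff span_monos_def)
  then show "carrier (mpoly_ring V) \<noteq> (mono_prime V A :: ('v, 'k) mpoly set)"
    by blast
  fix f g :: "('v, 'k) mpoly"
  assume fg: "f \<in> carrier (mpoly_ring V)" "g \<in> carrier (mpoly_ring V)"
    and prod: "f \<otimes>\<^bsub>mpoly_ring V\<^esub> g \<in> mono_prime V A"
  show "f \<in> mono_prime V A \<or> g \<in> mono_prime V A"
  proof (rule ccontr)
    assume "\<not> ?thesis"
    then have ne: "{p \<in> keys f. keys p \<inter> A = {}} \<noteq> {}" "{q \<in> keys g. keys q \<inter> A = {}} \<noteq> {}"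
      using fg by (auto simp: mem_mono_prime_iff)
    have "\<exists>p\<in>{p \<in> keys f. keys p \<inter> A = {}}. \<exists>q\<in>{q \<in> keys g. keys q \<inter> A = {}}.
        p + q \<in> keys (f * g)"
    proof (rule ex_add_mem_keys_mult[OF assms])
      fix p q p' q'
      assume *: "p \<in> {p \<in> keys f. keys p \<inter> A = {}}" "q \<in> {q \<in> keys g. keys q \<inter> A = {}}"
        "p' \<in> keys f" "q' \<in> keys g" "p' + q' = p + q"
      have "keys p' \<union> keys q' = keys p \<union> keys q"
        using *(5) keys_add_nat by metis
      with * show "p' \<in> {p \<in> keys f. keys p \<inter> A = {}} \<and> q' \<in> {q \<in> keys g. keys q \<inter> A = {}}"
        by blast
    qed (use fg ne in \<open>auto simp: span_monos_def\<close>)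
    then show False
      using prod by (fastforce simp: mem_mono_prime_iff keys_add_nat)
  qed
qed

text \<open>Says that the colon of the monomial ideal by the monomial \<open>m\<close> is the prime
  generated by the variables in \<open>A\<close>. The case \<open>n = 0\<close> forces
  \<open>m \<notin> E\<close>.\<close>

definition assoc_set :: "'v set \<Rightarrow> ('v \<Rightarrow>\<^sub>0 nat) set \<Rightarrow> 'v set \<Rightarrow> bool" where
  "assoc_set V E A \<longleftrightarrow>
    A \<subseteq> V \<and> (\<exists>m\<in>exps V. \<forall>n\<in>exps V. n + m \<in> E \<longleftrightarrow> keys n \<inter> A \<noteq> {})"

text \<open>Multiplication by a single monomial merely translates the support, so the condition on
  exponents describes the annihilator exactly.\<close>

lemma mono_prime_mem_assoc_primes:
  assumes "finite V" "exp_ideal V E" "assoc_set V E A"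
  shows "mono_prime V A \<in> assoc_primes (mpoly_ring V) (span_monos E :: ('v, 'k::field) mpoly set)"
proof -
  obtain m where m: "m \<in> exps V" "\<And>n. n \<in> exps V \<Longrightarrow> n + m \<in> E \<longleftrightarrow> keys n \<inter> A \<noteq> {}"
    using assms(3) by (auto simp: assoc_set_def)
  have "r * single m 1 \<in> span_monos E \<longleftrightarrow> r \<in> mono_prime V A"
    if "r \<in> span_monos (exps V)" for r :: "('v, 'k) mpoly"
  proof -
    have "keys (r * single m 1) = (+) m ` keys r"
      using keys_single_times[of "1::'k" m r] by (simp add: mult.commute)
    with that m(2) show ?thesis
      by (auto simp: mem_mono_prime_iff span_monos_def add.commute[of m] subset_iff)
  qed
  then have "mono_prime V A = {r \<in> span_monos (exps V). r * single m 1 \<in> (span_monos E :: ('v, 'k) mpoly set)}"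
    by (auto simp: mem_mono_prime_iff)
  then show ?thesis
    using m(1) primeideal_mono_prime[OF assms(1), of A, where 'k = 'k]
    by (auto simp: mem_assoc_primes_iff[OF cring_mpoly_ring ideal_span_monos[OF assms(2)]]
        intro!: bexI[of _ "single m 1"] span_monos_single)
qed

text \<open>What finite generation contributes: once the exponent of a variable reaches
  \<open>N\<close>, one more factor of it brings nothing new into the ideal.\<close>

definition bounded_exps :: "'v set \<Rightarrow> ('v \<Rightarrow>\<^sub>0 nat) set \<Rightarrow> bool" where
  "bounded_exps V E \<longleftrightarrow>
    (\<exists>N. \<forall>v\<in>V. \<forall>m\<in>exps V. N \<le> lookup m v \<longrightarrow> m + single v 1 \<in> E \<longrightarrow> m \<in> E)"

text \<open>The factor \<open>u\<close> is stripped off one unit at a time: the inner induction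
  lowers the power of one variable, the outer one runs through the support of \<open>u\<close>. The
  exponents never fall below those of \<open>m\<close>, so the bound keeps applying.\<close>

lemma add_large_exps_mem:
  assumes N: "\<And>v m. \<lbrakk>v \<in> V; m \<in> exps V; N \<le> lookup m v; m + single v 1 \<in> E\<rbrakk> \<Longrightarrow> m \<in> E"
    and u: "u \<in> exps V" and m: "m \<in> exps V" "\<And>v. v \<in> keys u \<Longrightarrow> N \<le> lookup m v"
    and "u + m \<in> E"
  shows "m \<in> E"
proof -
  have single: "n \<in> E"
    if "v \<in> V" "N \<le> lookup n v" "n \<in> exps V" "single v k + n \<in> E" for v k n
    using that
  proof (induction k)
    case (Suc k)
    have "single v (Suc k) + n = (single v k + n) + single v 1"
      using single_add[of v k 1] by (simp add: ac_simps)
    with Suc show ?case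
      using N[of v "single v k + n"] by (auto simp: lookup_add)
  qed simp
  have "n \<in> E" if "finite W" "W \<subseteq> keys u" "n \<in> exps V" "\<And>v. v \<in> W \<Longrightarrow> N \<le> lookup n v"
    "(\<Sum>v\<in>W. single v (lookup u v)) + n \<in> E" for W n
    using that
  proof (induction W arbitrary: n rule: finite_induct)
    case (insert v W)
    have v: "v \<in> V"
      using insert.prems u by (auto simp: exps_def)
    have "(\<Sum>v\<in>W. single v (lookup u v)) + (single v (lookup u v) + n) \<in> E"
      using insert.prems(4) insert.hyps by (simp add: ac_simps)
    moreover have "W \<subseteq> keys u" "single v (lookup u v) + n \<in> exps V"
      "\<And>w. w \<in> W \<Longrightarrow> N \<le> lookup (single v (lookup u v) + n) w"
      using insert.prems(1-3) v by (simp_all add: lookup_add trans_le_add2)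
    ultimately have "single v (lookup u v) + n \<in> E"
      using insert.IH by blast
    then show ?case
      using insert.prems(2,3) v single[of v n "lookup u v"] by simp
  qed simp
  from this[of "keys u" m] show ?thesis
    using m \<open>u + m \<in> E\<close> poly_mapping_sum_single[of u] by (simp flip: poly_mapping_sum_single)
qed

text \<open>Among the monomials \<open>n\<close> with \<open>n f \<notin> I\<close>, take one whose exponents, truncated at the bound
  \<open>N\<close>, have the largest sum. A variable outside the set \<open>A\<close> of those \<open>x\<close> with \<open>x n f \<in> I\<close> then has
  exponent at least \<open>N\<close> in \<open>n\<close>, so that multiplication by it no longer affects membership in \<open>I\<close>.\<close>

lemma assoc_prime_subset_mono_prime:
  assumes "finite V" "exp_ideal V E" "bounded_exps V E"
    and P: "P \<in> assoc_primes (mpoly_ring V) (span_monos E :: ('v, 'k::field) mpoly set)"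
  shows "\<exists>A. assoc_set V E A \<and> P \<subseteq> mono_prime V A"
proof -
  obtain N where N: "\<And>v m. \<lbrakk>v \<in> V; m \<in> exps V; N \<le> lookup m v; m + single v 1 \<in> E\<rbrakk> \<Longrightarrow> m \<in> E"
    using assms(3) unfolding bounded_exps_def by blast
  obtain f where prime: "primeideal P (mpoly_ring V)" and f: "f \<in> span_monos (exps V)"
    and Pf: "P = {r \<in> span_monos (exps V). r * f \<in> span_monos E}"
    using P by (auto simp: mem_assoc_primes_iff[OF cring_mpoly_ring ideal_span_monos[OF assms(2)]])
  have f_exps: "m \<in> exps V" if "m \<in> keys f" for m
    using that f by (auto simp: span_monos_def)
  \<comment> \<open>\<open>B n\<close> collects the monomials of \<open>f\<close> that stay outside
    \<open>E\<close> when shifted by \<open>n\<close>; it is nonempty iff the monomial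
    \<open>n\<close> does not annihilate the class of \<open>f\<close>.\<close>
  define B where "B n = {m \<in> keys f. n + m \<notin> E}" for n
  define \<mu> where "\<mu> n = (\<Sum>v\<in>V. min N (lookup n v))" for n
  have "f \<notin> span_monos E"
  proof
    assume "f \<in> span_monos E"
    then have "r * f \<in> span_monos E" if "r \<in> span_monos (exps V)" for r
      using that span_monos_mult[of r "exps V" f E E] exp_idealD(4)[OF assms(2)] by blast
    then have "P = carrier (mpoly_ring V)"
      using Pf by auto
    then show False
      using primeideal.I_notcarr[OF prime] by simp
  qed
  then have "0 \<in> exps V \<and> B 0 \<noteq> {}"
    by (auto simp: B_def span_monos_def)
  \<comment> \<open>The truncation at \<open>N\<close> bounds the measure, so that a maximum exists
    although the exponents \<open>n\<close> are unbounded.\<close>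
  moreover have "\<mu> n < Suc (card V * N)" for n
    using sum_mono[of V "\<lambda>v. min N (lookup n v)" "\<lambda>_. N"] by (simp add: \<mu>_def)
  ultimately obtain n where n: "n \<in> exps V" "B n \<noteq> {}"
    and n_max: "\<And>n'. n' \<in> exps V \<Longrightarrow> B n' \<noteq> {} \<Longrightarrow> \<mu> n' \<le> \<mu> n"
    using ex_has_greatest_nat[of "\<lambda>n. n \<in> exps V \<and> B n \<noteq> {}" 0 \<mu> "Suc (card V * N)"]
    by (metis less_imp_le)
  define A where "A = {a \<in> V. B (n + single a 1) = {}}"
  have large: "N \<le> lookup n a" if a: "a \<in> V" "a \<notin> A" for a
  proof (rule ccontr)
    assume "\<not> N \<le> lookup n a"
    then have "\<mu> n < \<mu> (n + single a 1)"
      unfolding \<mu>_def using a(1) assms(1)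
      by (intro sum_strict_mono_ex1 bexI[of _ a] ballI) (simp_all add: lookup_add min.coboundedI2)
    moreover have "\<mu> (n + single a 1) \<le> \<mu> n"
      using a n by (intro n_max) (auto simp: A_def)
    ultimately show False
      by simp
  qed
  have outside: "u + (n + m) \<notin> E"
    if "u \<in> exps V" "keys u \<inter> A = {}" "m \<in> exps V" "n + m \<notin> E" for u m
  proof
    assume "u + (n + m) \<in> E"
    have le: "N \<le> lookup (n + m) v" if "v \<in> keys u" for v
    proof -
      have "N \<le> lookup n v"
        using \<open>u \<in> exps V\<close> \<open>keys u \<inter> A = {}\<close> that by (intro large) (auto simp: exps_def)
      then show ?thesis
        by (simp add: lookup_add)
    qed
    have "n + m \<in> E"
    proof (rule add_large_exps_mem)
      show "m \<in> E" if "v \<in> V" "m \<in> exps V" "N \<le> lookup m v" "m + single v 1 \<in> E" for v m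
        using that by (rule N)
    qed (use that n le \<open>u + (n + m) \<in> E\<close> in simp_all)
    with that show False
      by simp
  qed
  \<comment> \<open>A single variable of \<open>A\<close> already moves every monomial of
    \<open>f\<close>, shifted by \<open>n\<close>, into \<open>E\<close>, and the remaining factor
    \<open>u'\<close> keeps it there.\<close>
  have inside: "u + (n + m) \<in> E"
    if u: "u \<in> exps V" "keys u \<inter> A \<noteq> {}" and m: "m \<in> keys f" for u m
  proof -
    obtain a where a: "a \<in> keys u" "a \<in> A"
      using u by blast
    define u' where "u' = u - single a 1"
    have u': "u = u' + single a 1"
      using a by (intro poly_mapping_eqI)
        (auto simp: u'_def lookup_add lookup_minus lookup_single when_def in_keys_iff)
    have "n + single a 1 + m \<in> E"
      using a m by (auto simp: A_def B_def)
    then have "u' + (n + single a 1 + m) \<in> E"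
      using u u' exp_idealD(4)[OF assms(2), of "n + single a 1 + m" u'] by simp
    then show ?thesis
      by (simp add: u' ac_simps)
  qed
  obtain m where m: "m \<in> keys f" "n + m \<notin> E"
    using n by (auto simp: B_def)
  have "assoc_set V E A"
    unfolding assoc_set_def
  proof (intro conjI bexI[of _ "n + m"] ballI)
    fix u assume u: "u \<in> exps V"
    show "u + (n + m) \<in> E \<longleftrightarrow> keys u \<inter> A \<noteq> {}"
      using outside[OF u _ f_exps m(2)] inside[OF u _ m(1)] m by blast
  qed (use n m f_exps in \<open>auto simp: A_def\<close>)
  moreover have "r \<in> mono_prime V A" if "r \<in> P" for r
  proof (rule ccontr)
    assume "r \<notin> mono_prime V A"
    have r: "r \<in> span_monos (exps V)" "r * f \<in> span_monos E"
      using that Pf by auto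
    have r_exps: "p \<in> exps V" if "p \<in> keys r" for p
      using that r by (auto simp: span_monos_def)
    \<comment> \<open>If \<open>r\<close> had a monomial avoiding \<open>A\<close>, such monomials
      times those in \<open>B n\<close> would leave in \<open>r * f\<close> a monomial that stays
      outside \<open>E\<close> after the shift by \<open>n\<close>. But all monomials of
      \<open>r * f\<close> lie in \<open>E\<close>.\<close>
    have "\<exists>p\<in>{p \<in> keys r. keys p \<inter> A = {}}. \<exists>q\<in>B n. p + q \<in> keys (r * f)"
    proof (rule ex_add_mem_keys_mult[OF assms(1)])
      show "{p \<in> keys r. keys p \<inter> A = {}} \<noteq> {}"
        using \<open>r \<notin> mono_prime V A\<close> r by (auto simp: mem_mono_prime_iff)
      fix p q p' q'
      assume pq: "p \<in> {p \<in> keys r. keys p \<inter> A = {}}" "q \<in> B n" "p' \<in> keys r" "q' \<in> keys f"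
        and eq: "p' + q' = p + q"
      have "p + (n + q) \<notin> E"
        using pq f_exps r_exps by (intro outside) (auto simp: B_def)
      then have *: "p' + (n + q') \<notin> E"
        using eq by (metis add.left_commute)
      then have "n + q' \<notin> E" "keys p' \<inter> A = {}"
        using pq r_exps[of p'] inside[of p' q'] exp_idealD(4)[OF assms(2), of "n + q'" p'] by auto
      then show "p' \<in> {p \<in> keys r. keys p \<inter> A = {}} \<and> q' \<in> B n"
        using pq by (simp add: B_def)
    qed (use n r f in \<open>auto simp: B_def span_monos_def\<close>)
    then obtain p q where pq: "p \<in> keys r" "keys p \<inter> A = {}" "q \<in> B n" "p + q \<in> keys (r * f)"
      by auto
    then have "n + (p + q) \<in> E"
      using r n exp_idealD(4)[OF assms(2), of "p + q" n] by (auto simp: span_monos_def)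
    then show False
      using outside[of p q] pq r_exps f_exps by (auto simp: B_def add.left_commute)
  qed
  ultimately show ?thesis
    by blast
qed

text \<open>Contraction from the localization at \<open>mono_prime V A\<close>, with denominators
  restricted to monomials avoiding \<open>A\<close>.\<close>

definition exp_contraction :: "'v set \<Rightarrow> 'v set \<Rightarrow> ('v \<Rightarrow>\<^sub>0 nat) set \<Rightarrow> ('v \<Rightarrow>\<^sub>0 nat) set" where
  "exp_contraction V A F = {m \<in> exps V. \<exists>u\<in>exps V. keys u \<inter> A = {} \<and> m + u \<in> F}"

text \<open>An arbitrary polynomial denominator can be replaced by monomial ones. If
  \<open>p + q\<close> survives in \<open>u * f\<close>, where \<open>p\<close> avoids
  \<open>A\<close>, then \<open>p\<close> itself is a multiplier for \<open>q\<close>; only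
  cancellation stands in the way.\<close>

lemma keys_subset_exp_contraction:
  fixes f u :: "('v, 'k::field) mpoly"
  assumes "finite V" "A \<subseteq> V" "exp_ideal V F"
    and f: "f \<in> span_monos (exps V)" and u: "u \<in> span_monos (exps V)" "u \<notin> mono_prime V A"
    and uf: "u * f \<in> span_monos F"
  shows "keys f \<subseteq> exp_contraction V A F"
proof (rule ccontr)
  assume bad: "\<not> ?thesis"
  define Z where "Z = keys f - exp_contraction V A F"
  define degA where "degA q = (\<Sum>a\<in>A. lookup q a)" for q :: "'v \<Rightarrow>\<^sub>0 nat"
  have degA_add: "degA (p + q) = degA p + degA q" for p q
    by (simp add: degA_def lookup_add sum.distrib)
  have degA_0: "degA q = 0 \<longleftrightarrow> keys q \<inter> A = {}" for q
    using finite_subset[OF assms(2,1)] by (auto simp: degA_def in_keys_iff disjoint_iff)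
  have exps: "p \<in> exps V" if "p \<in> keys u \<or> p \<in> keys f" for p
    using that f u by (auto simp: span_monos_def)
  have "Z \<noteq> {}" "finite Z"
    using bad by (auto simp: Z_def)
  then have "Min (degA ` Z) \<in> degA ` Z"
    by simp
  \<comment> \<open>The bad monomials of least degree in the variables of \<open>A\<close> cannot cancel.\<close>
  then have "\<exists>p\<in>{p \<in> keys u. keys p \<inter> A = {}}. \<exists>q\<in>{q \<in> Z. degA q = Min (degA ` Z)}.
      p + q \<in> keys (u * f)"
  proof (intro ex_add_mem_keys_mult[OF assms(1)])
    show "{p \<in> keys u. keys p \<inter> A = {}} \<noteq> {}"
      using u by (auto simp: mem_mono_prime_iff)
    fix p q p' q'
    assume pq: "p \<in> {p \<in> keys u. keys p \<inter> A = {}}" "q \<in> {q \<in> Z. degA q = Min (degA ` Z)}"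
      "p' \<in> keys u" "q' \<in> keys f" and eq: "p' + q' = p + q"
    \<comment> \<open>A multiplier \<open>t\<close> for \<open>q'\<close> would give the multiplier
      \<open>p + t\<close> for \<open>q\<close>, because \<open>p' + q' = p + q\<close>.\<close>
    have q': "q' \<in> Z"
    proof (rule ccontr)
      assume "q' \<notin> Z"
      then obtain t where t: "t \<in> exps V" "keys t \<inter> A = {}" "q' + t \<in> F"
        using pq by (auto simp: Z_def exp_contraction_def)
      then have "p' + (q' + t) \<in> F"
        using pq exps[of p'] exp_idealD(4)[OF assms(3), of "q' + t" p'] by auto
      then have "q + (p + t) \<in> F"
        using eq by (metis add.assoc add.commute)
      moreover have "keys (p + t) \<inter> A = {}" "p + t \<in> exps V"
        using t pq exps by (auto simp: keys_add_nat)
      ultimately have "q \<in> exp_contraction V A F"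
        unfolding exp_contraction_def using pq exps[of q] by (auto simp: Z_def intro!: bexI[of _ "p + t"])
      then show False
        using pq by (simp add: Z_def)
    qed
    then have "degA q \<le> degA q'"
      using pq \<open>finite Z\<close> by simp
    moreover have "degA p' + degA q' = degA q"
      using eq pq degA_add degA_0[of p] by (metis (mono_tags, lifting) add_0 mem_Collect_eq)
    ultimately show "p' \<in> {p \<in> keys u. keys p \<inter> A = {}} \<and> q' \<in> {q \<in> Z. degA q = Min (degA ` Z)}"
      using q' pq degA_0[of p'] by auto
  qed (use f u in \<open>auto simp: Z_def span_monos_def\<close>)
  then obtain p q where "p \<in> keys u" "keys p \<inter> A = {}" "q \<in> Z" "p + q \<in> F"
    using uf by (auto simp: span_monos_def)
  then show False
    using exps[of p] exps[of q] by (auto simp: Z_def exp_contraction_def add.commute[of p])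
qed

lemma local_contraction_mono_prime:
  assumes "finite V" "A \<subseteq> V" "exp_ideal V F"
  shows "local_contraction (mpoly_ring V) (mono_prime V A) (span_monos F) =
    (span_monos (exp_contraction V A F) :: ('v, 'k::field) mpoly set)"
proof -
  have "(\<exists>u\<in>span_monos (exps V) - mono_prime V A. u * f \<in> span_monos F) \<longleftrightarrow>
      f \<in> span_monos (exp_contraction V A F)"
    if f: "f \<in> span_monos (exps V)" for f :: "('v, 'k) mpoly"
  proof
    assume "\<exists>u\<in>span_monos (exps V) - mono_prime V A. u * f \<in> span_monos F"
    then show "f \<in> span_monos (exp_contraction V A F)"
      using keys_subset_exp_contraction[OF assms f] by (auto simp: span_monos_def)
  next
    assume "f \<in> span_monos (exp_contraction V A F)"
    then have "\<forall>m\<in>keys f. \<exists>t. t \<in> exps V \<and> keys t \<inter> A = {} \<and> m + t \<in> F"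
      by (auto simp: span_monos_def exp_contraction_def)
    then obtain t where t: "\<And>m. m \<in> keys f \<Longrightarrow> t m \<in> exps V \<and> keys (t m) \<inter> A = {} \<and> m + t m \<in> F"
      by metis
    \<comment> \<open>A common denominator for all monomials of \<open>f\<close>: the product of
      their individual multipliers, which still avoids \<open>A\<close>.\<close>
    define w where "w = (\<Sum>m\<in>keys f. t m)"
    have w_exps: "w \<in> exps (V - A)"
      unfolding w_def using t by (intro sum_in_exps) (fastforce simp: exps_def)
    then have "w \<in> exps V" "keys w \<inter> A = {}"
      by (auto simp: exps_def)
    moreover have "w + m \<in> F" if m: "m \<in> keys f" for m
    proof -
      have "w = t m + (\<Sum>m\<in>keys f - {m}. t m)"
        unfolding w_def using m by (simp add: sum.remove)
      moreover have "(m + t m) + (\<Sum>m\<in>keys f - {m}. t m) \<in> F"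
        using t m by (intro exp_idealD(3)[OF assms(3), of "m + t m"] sum_in_exps) auto
      ultimately show ?thesis
        by (simp add: ac_simps)
    qed
    ultimately show "\<exists>u\<in>span_monos (exps V) - mono_prime V A. u * f \<in> span_monos F"
      by (intro bexI[of _ "single w 1"])
        (auto simp: span_monos_def mem_mono_prime_iff keys_single_times)
  qed
  moreover have "span_monos (exp_contraction V A F) \<subseteq> (span_monos (exps V) :: ('v, 'k) mpoly set)"
    by (auto simp: span_monos_def exp_contraction_def)
  ultimately show ?thesis
    using local_contraction_prime[OF primeideal_mono_prime[OF assms(1), of A, where 'k = 'k]
        ideal_span_monos[OF assms(3)]]
    by auto
qed

definition exp_symbolic :: "'v set \<Rightarrow> ('v \<Rightarrow>\<^sub>0 nat) set \<Rightarrow> nat \<Rightarrow> ('v \<Rightarrow>\<^sub>0 nat) set" where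
  "exp_symbolic V E s =
    exps V \<inter> (\<Inter>A \<in> Collect (assoc_set V E). exp_contraction V A (exp_power V E s))"

lemma symbolic_power_span_monos:
  assumes "finite V" "exp_ideal V E" "bounded_exps V E"
  shows "symbolic_power (mpoly_ring V) (span_monos E) s =
    (span_monos (exp_symbolic V E s) :: ('v, 'k::field) mpoly set)" (is "?S = _")
proof
  let ?R = "mpoly_ring V :: ('v, 'k) mpoly ring"
  let ?J = "span_monos (exp_power V E s) :: ('v, 'k) mpoly set"
  have J: "ideal ?J ?R"
    by (intro ideal_span_monos exp_ideal_exp_power assms)
  have contr: "local_contraction ?R (mono_prime V A) ?J =
      span_monos (exp_contraction V A (exp_power V E s))" if "assoc_set V E A" for A
    using that assms
    by (intro local_contraction_mono_prime exp_ideal_exp_power) (auto simp: assoc_set_def)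
  show "?S \<subseteq> span_monos (exp_symbolic V E s)"
  proof
    fix f assume f: "f \<in> ?S"
    have "f \<in> span_monos (exp_contraction V A (exp_power V E s))" if A: "assoc_set V E A" for A
      using f mono_prime_mem_assoc_primes[OF assms(1,2) A, where 'k = 'k] contr[OF A]
      by (auto simp: symbolic_power_def ideal_power_span_monos[OF assms(2)])
    moreover have "f \<in> span_monos (exps V)"
      using f by (simp add: symbolic_power_def)
    ultimately show "f \<in> span_monos (exp_symbolic V E s)"
      by (auto simp: span_monos_def exp_symbolic_def)
  qed
  show "span_monos (exp_symbolic V E s) \<subseteq> ?S"
  proof
    fix f :: "('v, 'k) mpoly" assume f: "f \<in> span_monos (exp_symbolic V E s)"
    have "f \<in> local_contraction ?R P ?J" if P: "P \<in> assoc_primes ?R (span_monos E)" for P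
    proof -
      obtain A where A: "assoc_set V E A" "P \<subseteq> mono_prime V A"
        using assoc_prime_subset_mono_prime[OF assms P] by blast
      have "f \<in> span_monos (exp_contraction V A (exp_power V E s))"
        using f A by (auto simp: span_monos_def exp_symbolic_def)
      then have "f \<in> local_contraction ?R (mono_prime V A) ?J"
        using contr[OF A(1)] by simp
      moreover have "primeideal P ?R"
        using P by (simp add: assoc_primes_def)
      \<comment> \<open>Every multiplier outside \<open>mono_prime V A\<close> is also outside the
        smaller prime \<open>P\<close>.\<close>
      ultimately show ?thesis
        using A(2) local_contraction_prime[OF _ J] primeideal_mono_prime[OF assms(1), of A, where 'k = 'k]
        by auto
    qed
    moreover have "f \<in> span_monos (exps V)"
      using f by (auto simp: span_monos_def exp_symbolic_def)
    ultimately show "f \<in> ?S"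
      by (auto simp: symbolic_power_def ideal_power_span_monos[OF assms(2)])
  qed
qed

lemma symbolic_eq_ordinary_iff:
  assumes "finite V" "exp_ideal V E" "bounded_exps V E"
  shows "symbolic_power (mpoly_ring V) (span_monos E :: ('v, 'k::field) mpoly set) s =
      ideal_power (mpoly_ring V) (span_monos E) s \<longleftrightarrow> exp_symbolic V E s = exp_power V E s"
  by (simp add: symbolic_power_span_monos[OF assms] ideal_power_span_monos[OF assms(2)]
      span_monos_eq_iff)

section \<open>Scaling exponents\<close>

definition scale_exp :: "('v \<Rightarrow> nat) \<Rightarrow> ('v \<Rightarrow>\<^sub>0 nat) \<Rightarrow> ('v \<Rightarrow>\<^sub>0 nat)" where
  "scale_exp c m = Poly_Mapping.mapp (\<lambda>v k. c v * k) m"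

text \<open>For positive \<open>c\<close> this is the componentwise largest \<open>e\<close> such
  that the monomial \<open>scale_exp c e\<close> divides \<open>m\<close>. Both maps fix zero
  entries, as \<open>mapp\<close> requires.\<close>

definition floor_exp :: "('v \<Rightarrow> nat) \<Rightarrow> ('v \<Rightarrow>\<^sub>0 nat) \<Rightarrow> ('v \<Rightarrow>\<^sub>0 nat)" where
  "floor_exp c m = Poly_Mapping.mapp (\<lambda>v k. k div c v) m"

lemma lookup_scale_exp [simp]: "lookup (scale_exp c m) v = c v * lookup m v"
  by (simp add: scale_exp_def lookup_mapp when_def in_keys_iff)

lemma lookup_floor_exp [simp]: "lookup (floor_exp c m) v = lookup m v div c v"
  by (simp add: floor_exp_def lookup_mapp when_def in_keys_iff)

lemma exp_ideal_le:
  assumes "exp_ideal V E" "m \<in> E" "n \<in> exps V" "\<And>v. lookup m v \<le> lookup n v"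
  shows "n \<in> E"
proof -
  have n: "n = m + (n - m)"
    using assms(4) by (intro poly_mapping_eqI) (simp add: lookup_add lookup_minus)
  then have "n - m \<in> exps V"
    using assms(3) by (metis add_in_exps_iff)
  then show ?thesis
    using n exp_idealD(3)[OF assms(1,2)] by metis
qed

text \<open>\<open>pullback E\<close> below is the set of exponents of the extension of the ideal with exponents \<open>E\<close>
  along the substitution \<open>x \<mapsto> x ^ c x\<close>.\<close>

locale exp_scaling =
  fixes V :: "'v set" and c :: "'v \<Rightarrow> nat"
  assumes finite_V: "finite V" and c_pos: "c v > 0"
begin

definition pullback :: "('v \<Rightarrow>\<^sub>0 nat) set \<Rightarrow> ('v \<Rightarrow>\<^sub>0 nat) set" where
  "pullback E = {m \<in> exps V. floor_exp c m \<in> E}"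

lemma keys_scale_exp [simp]: "keys (scale_exp c m) = keys m"
proof -
  have "lookup (scale_exp c m) v \<noteq> 0 \<longleftrightarrow> lookup m v \<noteq> 0" for v
    using c_pos[of v] by simp
  then show ?thesis
    by (simp add: in_keys_iff set_eq_iff del: lookup_scale_exp)
qed

lemma scale_exp_in_exps [simp]: "scale_exp c m \<in> exps V \<longleftrightarrow> m \<in> exps V"
  by (simp add: exps_def)

lemma floor_exp_in_exps [simp]: "m \<in> exps V \<Longrightarrow> floor_exp c m \<in> exps V"
  using keys_mapp_subset[of "\<lambda>v k. k div c v" m] by (simp add: exps_def floor_exp_def subset_trans)

lemma floor_exp_scale_add [simp]: "floor_exp c (scale_exp c n + m) = n + floor_exp c m"
proof (rule poly_mapping_eqI)
  show "lookup (floor_exp c (scale_exp c n + m)) v = lookup (n + floor_exp c m) v" for v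
    using c_pos[of v] by (simp add: lookup_add)
qed

lemma floor_exp_scale [simp]: "floor_exp c (scale_exp c n) = n"
proof (rule poly_mapping_eqI)
  show "lookup (floor_exp c (scale_exp c n)) v = lookup n v" for v
    using c_pos[of v] by simp
qed

text \<open>Lifts a decomposition of the floor: the first summand is scaled, and all division
  remainders go into the second.\<close>

lemma le_floor_expE:
  assumes "floor_exp c m = e + f"
  obtains m' where "m = scale_exp c e + m'" "floor_exp c m' = f"
proof
  have "c v * lookup e v \<le> lookup m v" for v
  proof -
    have "lookup m v div c v = lookup e v + lookup f v"
      using arg_cong[OF assms, of "\<lambda>p. lookup p v"] by (simp add: lookup_add)
    then have "c v * lookup e v \<le> c v * (lookup m v div c v)"
      by simp
    then show ?thesis
      using times_div_less_eq_dividend order_trans by blast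
  qed
  then show m: "m = scale_exp c e + (m - scale_exp c e)"
    by (intro poly_mapping_eqI) (simp add: lookup_add lookup_minus)
  have "e + floor_exp c (m - scale_exp c e) = e + f"
    using assms floor_exp_scale_add[of e "m - scale_exp c e"] by (simp flip: m)
  then show "floor_exp c (m - scale_exp c e) = f"
    by simp
qed

text \<open>\<open>scale_exp c\<close> is a section of the floor map, so a set of exponents can be
  recovered from its pullback.\<close>

lemma pullback_eq_iff: "E \<subseteq> exps V \<Longrightarrow> F \<subseteq> exps V \<Longrightarrow> pullback E = pullback F \<longleftrightarrow> E = F"
proof
  assume sub: "E \<subseteq> exps V" "F \<subseteq> exps V" and eq: "pullback E = pullback F"
  have "e \<in> E \<longleftrightarrow> scale_exp c e \<in> pullback E" "e \<in> F \<longleftrightarrow> scale_exp c e \<in> pullback F" for e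
    using sub by (auto simp: pullback_def)
  then show "E = F"
    using eq by blast
qed simp

text \<open>The floor of \<open>m\<close> is divisible by \<open>g\<close> exactly when
  \<open>m\<close> is divisible by the scaled \<open>g\<close>; hence pulling back scales the
  generators.\<close>

lemma pullback_up_closure: "pullback (up_closure V G) = up_closure V (scale_exp c ` G)"
  if "G \<subseteq> exps V"
proof (intro equalityI subsetI)
  fix m assume "m \<in> pullback (up_closure V G)"
  then obtain g n where "floor_exp c m = g + n" "g \<in> G" "m \<in> exps V"
    by (auto simp: pullback_def up_closure_def)
  then show "m \<in> up_closure V (scale_exp c ` G)"
    by (elim le_floor_expE) (auto simp: up_closure_def)
next
  fix m assume "m \<in> up_closure V (scale_exp c ` G)"
  then obtain g n where "m = scale_exp c g + n" "g \<in> G" "n \<in> exps V"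
    by (auto simp: up_closure_def)
  then have "floor_exp c m = g + floor_exp c n" "g \<in> G" "floor_exp c n \<in> exps V" "m \<in> exps V"
    using that by auto
  then show "m \<in> pullback (up_closure V G)"
    unfolding pullback_def up_closure_def by blast
qed

text \<open>One inclusion lifts decompositions of the floor. The other holds because the floor is
  superadditive and products of exponent ideals are closed upwards.\<close>

lemma pullback_exp_sum:
  assumes "exp_ideal V E" "exp_ideal V F"
  shows "pullback (exp_sum E F) = exp_sum (pullback E) (pullback F)"
proof (intro equalityI subsetI)
  fix m assume "m \<in> pullback (exp_sum E F)"
  then obtain e f where ef: "floor_exp c m = e + f" "e \<in> E" "f \<in> F" "m \<in> exps V"
    by (auto simp: pullback_def exp_sum_def)
  then obtain m' where "m = scale_exp c e + m'" "floor_exp c m' = f"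
    by (elim le_floor_expE)
  with ef have "m = scale_exp c e + m'" "scale_exp c e \<in> pullback E" "m' \<in> pullback F"
    by (auto simp: pullback_def)
  then show "m \<in> exp_sum (pullback E) (pullback F)"
    by (auto simp: exp_sum_def)
next
  fix m assume "m \<in> exp_sum (pullback E) (pullback F)"
  then obtain a b where ab: "m = a + b" "a \<in> pullback E" "b \<in> pullback F"
    by (auto simp: exp_sum_def)
  have le: "lookup (floor_exp c a + floor_exp c b) v \<le> lookup (floor_exp c (a + b)) v" for v
  proof -
    have "c v * (lookup a v div c v + lookup b v div c v) \<le> lookup a v + lookup b v"
      unfolding distrib_left by (intro add_mono times_div_less_eq_dividend)
    then show ?thesis
      using c_pos by (simp add: lookup_add less_eq_div_iff_mult_less_eq mult.commute)
  qed
  have "floor_exp c a + floor_exp c b \<in> exp_sum E F"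
    using ab by (auto simp: exp_sum_def pullback_def)
  then have "floor_exp c (a + b) \<in> exp_sum E F"
    using ab le
      exp_ideal_le[OF exp_ideal_exp_sum[OF assms], of "floor_exp c a + floor_exp c b" "floor_exp c (a + b)"]
    by (auto simp: pullback_def)
  then show "m \<in> pullback (exp_sum E F)"
    using ab by (auto simp: pullback_def)
qed

lemma exp_power_pullback:
  assumes "exp_ideal V E"
  shows "exp_power V (pullback E) s = pullback (exp_power V E s)"
proof (induction s)
  case 0
  show ?case
    by (auto simp: pullback_def)
next
  case (Suc s)
  then show ?case
    using pullback_exp_sum[OF exp_ideal_exp_power[OF assms] assms] by simp
qed

text \<open>A witness \<open>m\<close> for \<open>E\<close> yields the largest exponent lying over \<open>m\<close> as a witness for the
  pullback: it is the one for which adding any single variable already changes the floor.\<close>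

lemma assoc_set_pullback: "assoc_set V (pullback E) A \<longleftrightarrow> assoc_set V E A"
proof
  assume "assoc_set V (pullback E) A"
  then obtain m where m: "A \<subseteq> V" "m \<in> exps V"
    "\<And>n. n \<in> exps V \<Longrightarrow> n + m \<in> pullback E \<longleftrightarrow> keys n \<inter> A \<noteq> {}"
    by (auto simp: assoc_set_def)
  have "n + floor_exp c m \<in> E \<longleftrightarrow> keys n \<inter> A \<noteq> {}" if "n \<in> exps V" for n
    using m(2) m(3)[of "scale_exp c n"] that by (simp add: pullback_def)
  then show "assoc_set V E A"
    unfolding assoc_set_def using m(1,2) floor_exp_in_exps by blast
next
  assume "assoc_set V E A"
  then obtain m where m: "A \<subseteq> V" "m \<in> exps V"
    "\<And>n. n \<in> exps V \<Longrightarrow> n + m \<in> E \<longleftrightarrow> keys n \<inter> A \<noteq> {}"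
    by (auto simp: assoc_set_def)
  define r where "r = (\<Sum>v\<in>V. single v (c v - 1))"
  have r_exps: "r \<in> exps V"
    unfolding r_def by (intro sum_in_exps) simp
  have lookup_r: "lookup r v = (if v \<in> V then c v - 1 else 0)" for v
    unfolding r_def lookup_sum using finite_V by (simp add: lookup_single when_def)
  have "n + (scale_exp c m + r) \<in> pullback E \<longleftrightarrow> keys n \<inter> A \<noteq> {}" if n: "n \<in> exps V" for n
  proof -
    \<comment> \<open>The remainders \<open>c v - 1\<close> are the largest possible: an entry
      \<open>k + (c v - 1)\<close> reaches \<open>c v\<close> exactly when \<open>k \<ge> 1\<close>.
      Hence adding \<open>n\<close> changes the floor precisely on the support of
      \<open>n\<close>.\<close>
    have "lookup (floor_exp c (n + r)) v \<noteq> 0 \<longleftrightarrow> lookup n v \<noteq> 0" if "v \<in> V" for v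
      using that c_pos[of v] by (auto simp: lookup_add lookup_r div_eq_0_iff)
    then have "keys (floor_exp c (n + r)) \<inter> A = keys n \<inter> A"
      using m(1) by (auto simp: in_keys_iff simp del: lookup_floor_exp)
    moreover have "floor_exp c (n + (scale_exp c m + r)) = floor_exp c (n + r) + m"
      using floor_exp_scale_add[of m "n + r"] by (simp add: ac_simps)
    ultimately show ?thesis
      using m(2) m(3)[of "floor_exp c (n + r)"] n r_exps by (simp add: pullback_def)
  qed
  then show "assoc_set V (pullback E) A"
    using m r_exps by (auto simp: assoc_set_def intro!: bexI[of _ "scale_exp c m + r"])
qed

text \<open>From left to right the multiplier \<open>u\<close> is kept, since for
  \<open>c \<ge> 1\<close> the floor of \<open>m + u\<close> is at most the floor of
  \<open>m\<close> plus \<open>u\<close>. From right to left it is scaled. Both leave its support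
  unchanged, so it still avoids \<open>A\<close>.\<close>

lemma exp_contraction_pullback:
  assumes "exp_ideal V F"
  shows "exp_contraction V A (pullback F) = pullback (exp_contraction V A F)"
proof -
  have eq: "(\<exists>u\<in>exps V. keys u \<inter> A = {} \<and> m + u \<in> pullback F) \<longleftrightarrow>
      (\<exists>u\<in>exps V. keys u \<inter> A = {} \<and> floor_exp c m + u \<in> F)" if m: "m \<in> exps V" for m
  proof
    assume "\<exists>u\<in>exps V. keys u \<inter> A = {} \<and> m + u \<in> pullback F"
    then obtain u where u: "u \<in> exps V" "keys u \<inter> A = {}" "floor_exp c (m + u) \<in> F"
      by (auto simp: pullback_def)
    have "lookup (floor_exp c (m + u)) v \<le> lookup (floor_exp c m + u) v" for v
    proof -
      have "(lookup m v + lookup u v) div c v \<le> (lookup m v + lookup u v * c v) div c v"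
        using c_pos[of v] by (intro div_le_mono) simp
      then show ?thesis
        using c_pos[of v] by (simp add: lookup_add)
    qed
    then have "floor_exp c m + u \<in> F"
      using u m exp_ideal_le[OF assms, of "floor_exp c (m + u)" "floor_exp c m + u"] by simp
    with u show "\<exists>u\<in>exps V. keys u \<inter> A = {} \<and> floor_exp c m + u \<in> F"
      by blast
  next
    assume "\<exists>u\<in>exps V. keys u \<inter> A = {} \<and> floor_exp c m + u \<in> F"
    then obtain u where u: "u \<in> exps V" "keys u \<inter> A = {}" "floor_exp c m + u \<in> F"
      by blast
    then show "\<exists>u\<in>exps V. keys u \<inter> A = {} \<and> m + u \<in> pullback F"
      using m floor_exp_scale_add[of u m]
      by (intro bexI[of _ "scale_exp c u"]) (simp_all add: pullback_def add.commute)
  qed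
  have pull: "pullback {m \<in> exps V. Q m} = {m \<in> exps V. Q (floor_exp c m)}" for Q
    by (auto simp: pullback_def)
  show ?thesis
    unfolding exp_contraction_def pull by (intro Collect_cong conj_cong refl eq)
qed

lemma exp_symbolic_pullback:
  assumes "exp_ideal V E"
  shows "exp_symbolic V (pullback E) s = pullback (exp_symbolic V E s)"
proof -
  have "assoc_set V (pullback E) = assoc_set V E"
    by (rule ext) (rule assoc_set_pullback)
  then have "exp_symbolic V (pullback E) s =
      exps V \<inter> (\<Inter>A \<in> Collect (assoc_set V E). pullback (exp_contraction V A (exp_power V E s)))"
    by (simp add: exp_symbolic_def exp_power_pullback[OF assms]
        exp_contraction_pullback[OF exp_ideal_exp_power[OF assms]])
  also have "\<dots> = pullback (exp_symbolic V E s)"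
    by (auto simp: pullback_def exp_symbolic_def)
  finally show ?thesis .
qed

lemma exp_symbolic_eq_power_pullback_iff:
  assumes "exp_ideal V E"
  shows "exp_symbolic V (pullback E) s = exp_power V (pullback E) s \<longleftrightarrow>
    exp_symbolic V E s = exp_power V E s"
  unfolding exp_symbolic_pullback[OF assms] exp_power_pullback[OF assms]
proof (rule pullback_eq_iff)
  show "exp_symbolic V E s \<subseteq> exps V"
    by (simp add: exp_symbolic_def)
  show "exp_power V E s \<subseteq> exps V"
    by (rule exp_idealD(1)[OF exp_ideal_exp_power[OF assms]])
qed

end

section \<open>Edge ideals\<close>

text \<open>\<open>N\<close> bounds all exponents in the generators. If \<open>m\<close> already has
  exponent at least \<open>N\<close> in \<open>v\<close>, the extra unit in
  \<open>m + single v 1 = g + n\<close> must be matched by one in the cofactor \<open>n\<close>,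
  from which it can be removed.\<close>

lemma bounded_exps_up_closure:
  assumes "finite V" "finite G"
  shows "bounded_exps V (up_closure V G)"
proof -
  have "finite ((\<lambda>(g, v). lookup g v) ` (G \<times> V))"
    using assms by simp
  then obtain N where "\<forall>k\<in>(\<lambda>(g, v). lookup g v) ` (G \<times> V). k \<le> N"
    unfolding finite_nat_set_iff_bounded_le by blast
  then have N: "lookup g v \<le> N" if "g \<in> G" "v \<in> V" for g v
    using that by simp
  have "m \<in> up_closure V G"
    if v: "v \<in> V" and m: "m \<in> exps V" "N \<le> lookup m v" "m + single v 1 \<in> up_closure V G" for v m
  proof -
    obtain g n where gn: "m + single v 1 = g + n" "g \<in> G" "n \<in> exps V"
      using m by (auto simp: up_closure_def)
    have eq: "lookup m w + lookup (single v 1) w = lookup g w + lookup n w" for w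
      using arg_cong[OF gn(1), of "\<lambda>p. lookup p w"] by (simp add: lookup_add)
    have "lookup n v \<ge> 1"
      using eq[of v] N[OF gn(2) v] m(2) by simp
    then have n: "n = (n - single v 1) + single v 1"
      by (intro poly_mapping_eqI) (auto simp: lookup_add lookup_minus lookup_single when_def)
    then have "m + single v 1 = (g + (n - single v 1)) + single v 1"
      using gn(1) by (simp add: add.assoc)
    then have "m = g + (n - single v 1)"
      by simp
    moreover have "n - single v 1 \<in> exps V"
      using gn(3) n by (metis add_in_exps_iff)
    ultimately show ?thesis
      using gn(2) by (auto simp: up_closure_def)
  qed
  then show ?thesis
    unfolding bounded_exps_def by blast
qed

definition edge_exps :: "('v, 'm) wo_graph_scheme \<Rightarrow> ('v \<Rightarrow>\<^sub>0 nat) set" where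
  "edge_exps D = (\<lambda>(x, y). single x 1 + single y (weight D y)) ` edges D"

lemma var_power: "var y ^ k = single (single y k) 1"
proof (induction k)
  case (Suc k)
  have "single y 1 + single y k = single y (Suc k)"
    using single_add[of y 1 k] by simp
  with Suc show ?case
    by (simp add: var_def mult_single)
qed simp

context weighted_oriented_graph
begin

lemma edge_exps_in_exps: "edge_exps D \<subseteq> exps (verts D)"
  using edges_in_verts by (auto simp: edge_exps_def)

lemma finite_edge_exps: "finite (edge_exps D)"
  unfolding edge_exps_def using finite_verts edges_in_verts
  by (intro finite_imageI) (meson finite_SigmaI finite_subset)

lemma edge_ideal_eq_span_monos:
  "(edge_ideal D :: ('v, 'k::field) mpoly set) = span_monos (up_closure (verts D) (edge_exps D))"
proof -
  have "(var x :: ('v, 'k) mpoly) * var y ^ weight D y = single (single x 1 + single y (weight D y)) 1" for x y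
    by (simp add: var_power) (simp add: var_def mult_single)
  then have "{var x * var y ^ weight D y |x y. (x, y) \<in> edges D} =
      (\<lambda>g. single g (1::'k)) ` edge_exps D"
    by (auto simp: edge_exps_def image_iff split: prod.splits)
  then show ?thesis
    unfolding edge_ideal_def using genideal_monomials[OF edge_exps_in_exps] by simp
qed

end

theorem corollary4p6:
  fixes D D' :: "'v wo_graph"
    and U :: "'v set"
    and R :: "('v, 'k::field) mpoly ring"
    and I I' :: "('v, 'k) mpoly set"
    and s :: nat
  assumes "weighted_oriented_graph D"
    and "U = {x \<in> nontrivial_verts D. is_sink D x}"
    and "D' = D\<lparr>weight := (\<lambda>x. if x \<in> U then 1 else weight D x)\<rparr>"
    and "R = mpoly_ring (verts D)"
    and "I = edge_ideal D"
    and "I' = edge_ideal D'"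
    and "s \<ge> 1"
  shows "symbolic_power R I' s = ideal_power R I' s
     \<longleftrightarrow> symbolic_power R I s = ideal_power R I s"
proof -
  interpret D: weighted_oriented_graph D by fact
  have D': "verts D' = verts D" "edges D' = edges D"
    "weight D' = (\<lambda>x. if x \<in> U then 1 else weight D x)"
    using assms(3) by simp_all
  interpret D': weighted_oriented_graph D'
  proof
    show "weight D' x = 1" if "is_source D' x" for x
      using that D.weight_source[of x] by (simp add: D' is_source_def)
    show "weight D' x \<ge> 1" if "x \<in> verts D'" for x
      using that D.weight_pos[of x] by (simp add: D')
  qed (simp_all add: D' D.finite_verts D.edges_in_verts D.no_loops D.one_orientation)
  define c where "c v = (if v \<in> U then weight D v else 1)" for v
  have c_pos: "c v > 0" for v
    using D.weight_pos[of v] assms(2) by (auto simp: c_def nontrivial_verts_def)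
  interpret exp_scaling "verts D" c
    by unfold_locales (auto simp: D.finite_verts c_pos)
  define E' where "E' = up_closure (verts D) (edge_exps D')"
  define E where "E = up_closure (verts D) (edge_exps D)"
  have exps': "edge_exps D' \<subseteq> exps (verts D)"
    using D'.edge_exps_in_exps by (simp add: D')
  have "scale_exp c (single x 1 + single y (weight D' y)) = single x 1 + single y (weight D y)"
    if "(x, y) \<in> edges D" for x y
  proof -
    \<comment> \<open>The tail of an edge is not a sink, so its exponent 1 is not scaled. The head
      has exponent 1 scaled to its weight if it lies in \<open>U\<close>, and otherwise keeps its
      weight.\<close>
    have "x \<notin> U"
      using that assms(2) by (auto simp: is_sink_def)
    then show ?thesis
      using that D.no_loops
      by (intro poly_mapping_eqI) (auto simp: lookup_add lookup_single when_def c_def D')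
  qed
  then have "scale_exp c ` edge_exps D' = edge_exps D"
    by (force simp: edge_exps_def D')
  then have E: "E = pullback E'"
    using pullback_up_closure[OF exps'] by (simp add: E_def E'_def)
  have ideals: "exp_ideal (verts D) E" "exp_ideal (verts D) E'"
    unfolding E_def E'_def using exps' D.edge_exps_in_exps by (auto intro: exp_ideal_up_closure)
  have bounded: "bounded_exps (verts D) E" "bounded_exps (verts D) E'"
    unfolding E_def E'_def
    by (auto intro: bounded_exps_up_closure D.finite_verts D.finite_edge_exps D'.finite_edge_exps)
  have "I = span_monos E" "I' = span_monos E'"
    using D.edge_ideal_eq_span_monos D'.edge_ideal_eq_span_monos
    by (simp_all add: assms(5,6) E_def E'_def D')
  then show ?thesis
    using symbolic_eq_ordinary_iff[OF D.finite_verts ideals(1) bounded(1), where 'k = 'k]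
      symbolic_eq_ordinary_iff[OF D.finite_verts ideals(2) bounded(2), where 'k = 'k]
      exp_symbolic_eq_power_pullback_iff[OF ideals(2)]
    by (simp add: assms(4) E)
qed

end
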